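(* Let $\mathcal{C}$ and $\mathcal{D}$ be two (strict) 2-categories. Let $F,G:\mathcal{C}\to\mathcal{D}$ be objects of $\mathbf{Fun}(\mathcal{C},\mathcal{D})$ and let $(\sigma,\rho,\eta,\epsilon)$ be an adjunction in the 2-category $\mathbf{Fun}(\mathcal{C},\mathcal{D})$, with $\sigma:F\Rightarrow G$, $\rho:G\Rightarrow F$, $\eta:\mathrm{id}_F\Rrightarrow\rho\circ\sigma$ and $\epsilon:\sigma\circ\rho\Rrightarrow\mathrm{id}_G$. Then $(\sigma(x),\rho(x),\eta(x),\epsilon(x))$, with $\sigma(x):F(x)\to G(x)$ and $\rho(x):G(x)\to F(x)$, is an adjunction in $\mathcal{D}$ for all objects $x$ in $\mathcal{C}$. Conversely, let $F,G:\mathcal{C}\to\mathcal{D}$ be two (strict) functors, let $\rho:G\Rightarrow F$ be a pseudo-natural transformation, and let $\sigma:\mathcal{C}_0\to\mathcal{D}_1$ and $\eta,\epsilon:\mathcal{C}_0\to\mathcal{D}_2$ be assignments (from objects of $\mathcal{C}$ to 1-morphisms, respectively 2-morphisms, of $\mathcal{D}$) such that $(\sigma(x),\rho(x),\eta(x),\epsilon(x))$ is an adjunction in $\mathcal{D}$, with $\sigma(x):F(x)\to G(x)$, $\eta(x):\mathrm{id}_{F(x)}\Rightarrow\rho(x)\sigma(x)$ and $\epsilon(x):\sigma(x)\rho(x)\Rightarrow\mathrm{id}_{G(x)}$, for all objects $x$ in $\mathcal{C}$. Then there exists an extension of $\sigma$ to an oplax-natural transformation $\sigma:F\Rightarrow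 G$ for which $\eta$ together with $\epsilon$ define modifications and $(\sigma,\rho,\eta,\epsilon)$ is an adjunction in $\mathbf{Fun}(\mathcal{C},\mathcal{D})$. Furthermore, $\sigma$ is unique up to a canonical isomorphism.
   Context: $\mathbf{Fun}(\mathcal{C},\mathcal{D})$ is the 2-category of strict functors $\mathcal{C}\to\mathcal{D}$, oplax-natural transformations, and modifications. Write $\cdot$ for vertical composition of 2-morphisms in $\mathcal{D}$ and juxtaposition for composition of 1-morphisms and whiskering. An oplax-natural transformation $\rho:F\Rightarrow G$ assigns to each object $x$ a 1-morphism $\rho(x):F(x)\to G(x)$ and to each 1-morphism $\alpha:x\to y$ a 2-morphism $\rho(\alpha):\rho(y)F(\alpha)\Rightarrow G(\alpha)\rho(x)$ such that $\rho(\mathrm{id}_x)=\mathrm{id}_{\rho(x)}$; $\rho(\alpha\beta)=(G(\alpha)\rho(\beta))\cdot(\rho(\alpha)F(\beta))$ for composable $\alpha,\beta$; and $(G(\Sigma)\rho(x))\cdot\rho(\alpha)=\rho(\gamma)\cdot(\rho(y)F(\Sigma))$ for every 2-morphism $\Sigma:\alpha\Rightarrow\gamma$ with $\alpha,\gamma:x\to y$. It is a pseudo-natural transformation if every $\rho(\alpha)$ is (vertically) invertible. The composite of $\rho:F\Rightarrow G$ followed by $\sigma:G\Rightarrow H$, here written $\sigma\circ\rho$, has $x\mapsto\sigma(x)\rho(x)$ and $\alpha\mapsto(\sigma(\alpha)\rho(x))\cdot(\sigma(y)\rho(\alpha))$. A modification $m:\sigma\Rrightarrow\rho$ between oplax-natural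 transformations $F\Rightarrow G$ assigns to each object $x$ a 2-morphism $m(x):\sigma(x)\Rightarrow\rho(x)$ with $\rho(\alpha)\cdot(m(y)F(\alpha))=(G(\alpha)m(x))\cdot\sigma(\alpha)$ for all $\alpha:x\to y$. Modifications are composed and whiskered componentwise. An adjunction in a 2-category is a quadruple $(f,g,\eta,\epsilon)$ with $f:x\to y$, $g:y\to x$, $\eta:\mathrm{id}_x\Rightarrow gf$, $\epsilon:fg\Rightarrow\mathrm{id}_y$ satisfying the zig-zag identities $(\epsilon f)\cdot(f\eta)=\mathrm{id}_f$ and $(g\epsilon)\cdot(\eta g)=\mathrm{id}_g$. "Unique up to a canonical isomorphism" is in the sense of uniqueness of left adjoints in a 2-category: if $(\sigma',\rho,\eta',\epsilon')$ is another adjunction in $\mathbf{Fun}(\mathcal{C},\mathcal{D})$, the canonical 2-morphism $(\epsilon\sigma')\cdot(\sigma\eta'):\sigma\Rrightarrow\sigma'$ is invertible. *)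

theory Defs
  imports "HOL-Library.FuncSet"
begin

text \<open>
  In a strict 2-category, \<open>g \<odot> f\<close> and \<open>\<tau> \<cdot> \<theta>\<close> mean ``\<open>g\<close> after \<open>f\<close>'' and
  ``\<open>\<tau>\<close> after \<open>\<theta>\<close>''; \<open>\<phi> \<star> \<theta>\<close> is horizontal composition in the same order.
  The operations are relevant only on composable elements of the carriers.
\<close>

record ('o, 'a, 't) two_cat =
  Obj :: "'o set"
  Arr :: "'a set"
  Cell :: "'t set"
  Dom :: "'a \<Rightarrow> 'o"
  Cod :: "'a \<Rightarrow> 'o"
  Src :: "'t \<Rightarrow> 'a"
  Trg :: "'t \<Rightarrow> 'a"
  Id1 :: "'o \<Rightarrow> 'a"
  Id2 :: "'a \<Rightarrow> 't"
  comp1 :: "'a \<Rightarrow> 'a \<Rightarrow> 'a"  (infixr \<open>\<odot>\<index>\<close> 75)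
  vcomp :: "'t \<Rightarrow> 't \<Rightarrow> 't"  (infixr \<open>\<cdot>\<index>\<close> 60)
  hcomp :: "'t \<Rightarrow> 't \<Rightarrow> 't"  (infixr \<open>\<star>\<index>\<close> 70)

definition hom1 :: "('o, 'a, 't) two_cat \<Rightarrow> 'o \<Rightarrow> 'o \<Rightarrow> 'a set"
  where "hom1 K x y = {f \<in> Arr K. Dom K f = x \<and> Cod K f = y}"

definition hom2 :: "('o, 'a, 't) two_cat \<Rightarrow> 'a \<Rightarrow> 'a \<Rightarrow> 't set"
  where "hom2 K f g = {\<theta> \<in> Cell K. Src K \<theta> = f \<and> Trg K \<theta> = g}"

abbreviation whiskerL :: "('o, 'a, 't) two_cat \<Rightarrow> 'a \<Rightarrow> 't \<Rightarrow> 't"  (infixr \<open>\<triangleright>\<index>\<close> 70)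
  where "whiskerL K f \<theta> \<equiv> Id2 K f \<star>\<^bsub>K\<^esub> \<theta>"

abbreviation whiskerR :: "('o, 'a, 't) two_cat \<Rightarrow> 't \<Rightarrow> 'a \<Rightarrow> 't"  (infixl \<open>\<triangleleft>\<index>\<close> 71)
  where "whiskerR K \<theta> f \<equiv> \<theta> \<star>\<^bsub>K\<^esub> Id2 K f"

locale two_category =
  fixes K :: "('o, 'a, 't) two_cat" (structure)
  assumes arr_ends: "f \<in> Arr K \<Longrightarrow> Dom K f \<in> Obj K \<and> Cod K f \<in> Obj K"
    and cell_ends: "\<theta> \<in> Cell K \<Longrightarrow> Src K \<theta> \<in> Arr K \<and> Trg K \<theta> \<in> Arr K
          \<and> Dom K (Src K \<theta>) = Dom K (Trg K \<theta>) \<and> Cod K (Src K \<theta>) = Cod K (Trg K \<theta>)"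
    and id1_hom: "x \<in> Obj K \<Longrightarrow> Id1 K x \<in> hom1 K x x"
    and comp1_hom: "\<lbrakk>f \<in> hom1 K x y; g \<in> hom1 K y z\<rbrakk> \<Longrightarrow> g \<odot> f \<in> hom1 K x z"
    and comp1_assoc: "\<lbrakk>f \<in> hom1 K w x; g \<in> hom1 K x y; h \<in> hom1 K y z\<rbrakk>
          \<Longrightarrow> (h \<odot> g) \<odot> f = h \<odot> (g \<odot> f)"
    and comp1_id: "f \<in> hom1 K x y \<Longrightarrow> Id1 K y \<odot> f = f \<and> f \<odot> Id1 K x = f"
    and id2_hom: "f \<in> Arr K \<Longrightarrow> Id2 K f \<in> hom2 K f f"
    and vcomp_hom: "\<lbrakk>\<theta> \<in> hom2 K f g; \<tau> \<in> hom2 K g h\<rbrakk> \<Longrightarrow> \<tau> \<cdot> \<theta> \<in> hom2 K f h"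
    and vcomp_assoc: "\<lbrakk>\<theta> \<in> hom2 K e f; \<tau> \<in> hom2 K f g; \<upsilon> \<in> hom2 K g h\<rbrakk>
          \<Longrightarrow> (\<upsilon> \<cdot> \<tau>) \<cdot> \<theta> = \<upsilon> \<cdot> (\<tau> \<cdot> \<theta>)"
    and vcomp_id: "\<theta> \<in> hom2 K f g \<Longrightarrow> Id2 K g \<cdot> \<theta> = \<theta> \<and> \<theta> \<cdot> Id2 K f = \<theta>"
    and hcomp_hom: "\<lbrakk>f \<in> hom1 K x y; \<theta> \<in> hom2 K f f'; g \<in> hom1 K y z; \<phi> \<in> hom2 K g g'\<rbrakk>
          \<Longrightarrow> \<phi> \<star> \<theta> \<in> hom2 K (g \<odot> f) (g' \<odot> f')"
    and hcomp_assoc: "\<lbrakk>f \<in> hom1 K w x; \<theta> \<in> hom2 K f f'; g \<in> hom1 K x y; \<phi> \<in> hom2 K g g';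
            h \<in> hom1 K y z; \<psi> \<in> hom2 K h h'\<rbrakk> \<Longrightarrow> (\<psi> \<star> \<phi>) \<star> \<theta> = \<psi> \<star> (\<phi> \<star> \<theta>)"
    and hcomp_unit: "\<lbrakk>f \<in> hom1 K x y; \<theta> \<in> hom2 K f f'\<rbrakk>
          \<Longrightarrow> Id1 K y \<triangleright> \<theta> = \<theta> \<and> \<theta> \<triangleleft> Id1 K x = \<theta>"
    and hcomp_id: "\<lbrakk>f \<in> hom1 K x y; g \<in> hom1 K y z\<rbrakk>
          \<Longrightarrow> Id2 K g \<star> Id2 K f = Id2 K (g \<odot> f)"
    and interchange: "\<lbrakk>f \<in> hom1 K x y; \<theta> \<in> hom2 K f f'; \<theta>' \<in> hom2 K f' f'';
            g \<in> hom1 K y z; \<phi> \<in> hom2 K g g'; \<phi>' \<in> hom2 K g' g''\<rbrakk>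
          \<Longrightarrow> (\<phi>' \<cdot> \<phi>) \<star> (\<theta>' \<cdot> \<theta>) = (\<phi>' \<star> \<theta>') \<cdot> (\<phi> \<star> \<theta>)"

definition invertible2 :: "('o, 'a, 't) two_cat \<Rightarrow> 't \<Rightarrow> bool"
  where "invertible2 K \<theta> \<longleftrightarrow> \<theta> \<in> Cell K \<and>
    (\<exists>\<tau> \<in> hom2 K (Trg K \<theta>) (Src K \<theta>).
       \<tau> \<cdot>\<^bsub>K\<^esub> \<theta> = Id2 K (Src K \<theta>) \<and> \<theta> \<cdot>\<^bsub>K\<^esub> \<tau> = Id2 K (Trg K \<theta>))"

definition adjunction ::
  "('o, 'a, 't) two_cat \<Rightarrow> 'o \<Rightarrow> 'o \<Rightarrow> 'a \<Rightarrow> 'a \<Rightarrow> 't \<Rightarrow> 't \<Rightarrow> bool"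
  where "adjunction K x y f g \<eta> \<epsilon> \<longleftrightarrow>
    x \<in> Obj K \<and> y \<in> Obj K \<and> f \<in> hom1 K x y \<and> g \<in> hom1 K y x \<and>
    \<eta> \<in> hom2 K (Id1 K x) (g \<odot>\<^bsub>K\<^esub> f) \<and> \<epsilon> \<in> hom2 K (f \<odot>\<^bsub>K\<^esub> g) (Id1 K y) \<and>
    (\<epsilon> \<triangleleft>\<^bsub>K\<^esub> f) \<cdot>\<^bsub>K\<^esub> (f \<triangleright>\<^bsub>K\<^esub> \<eta>) = Id2 K f \<and>
    (g \<triangleright>\<^bsub>K\<^esub> \<epsilon>) \<cdot>\<^bsub>K\<^esub> (\<eta> \<triangleleft>\<^bsub>K\<^esub> g) = Id2 K g"

text \<open>
  For adjunctions \<open>(f, g, \<eta>, \<epsilon>)\<close> and \<open>(f', g, \<eta>', \<epsilon>')\<close> with the same right adjoint,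
  the canonical comparison \<open>f \<Rightarrow> f'\<close>.
\<close>

definition left_adjoint_comparison ::
  "('o, 'a, 't) two_cat \<Rightarrow> 'a \<Rightarrow> 't \<Rightarrow> 'a \<Rightarrow> 't \<Rightarrow> 't"
  where "left_adjoint_comparison K f \<epsilon> f' \<eta>' = (\<epsilon> \<triangleleft>\<^bsub>K\<^esub> f') \<cdot>\<^bsub>K\<^esub> (f \<triangleright>\<^bsub>K\<^esub> \<eta>')"

text \<open>
  Functors, transformations and modifications are determined by their values on the
  carriers only; the component functions are therefore required to be \<^const>\<open>extensional\<close>
  (equal to \<^const>\<open>undefined\<close> elsewhere), so that HOL equality is the intended equality.
  Transformations and modifications also record their source and target.
\<close>

record ('o, 'a, 't, 'p, 'b, 'u) functor2 =
  fob :: "'o \<Rightarrow> 'p"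
  far :: "'a \<Rightarrow> 'b"
  fcell :: "'t \<Rightarrow> 'u"

definition strict_functor ::
  "('o, 'a, 't) two_cat \<Rightarrow> ('p, 'b, 'u) two_cat \<Rightarrow> ('o, 'a, 't, 'p, 'b, 'u) functor2 \<Rightarrow> bool"
  where "strict_functor C D F \<longleftrightarrow>
    fob F \<in> Obj C \<rightarrow>\<^sub>E Obj D \<and> far F \<in> extensional (Arr C) \<and> fcell F \<in> extensional (Cell C) \<and>
    (\<forall>x y. \<forall>\<alpha> \<in> hom1 C x y. far F \<alpha> \<in> hom1 D (fob F x) (fob F y)) \<and>
    (\<forall>\<alpha> \<gamma>. \<forall>\<Sigma> \<in> hom2 C \<alpha> \<gamma>. fcell F \<Sigma> \<in> hom2 D (far F \<alpha>) (far F \<gamma>)) \<and>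
    (\<forall>x \<in> Obj C. far F (Id1 C x) = Id1 D (fob F x)) \<and>
    (\<forall>x y z. \<forall>\<beta> \<in> hom1 C x y. \<forall>\<alpha> \<in> hom1 C y z.
       far F (\<alpha> \<odot>\<^bsub>C\<^esub> \<beta>) = far F \<alpha> \<odot>\<^bsub>D\<^esub> far F \<beta>) \<and>
    (\<forall>\<alpha> \<in> Arr C. fcell F (Id2 C \<alpha>) = Id2 D (far F \<alpha>)) \<and>
    (\<forall>\<alpha> \<beta> \<gamma>. \<forall>\<Sigma> \<in> hom2 C \<alpha> \<beta>. \<forall>\<Sigma>' \<in> hom2 C \<beta> \<gamma>.
       fcell F (\<Sigma>' \<cdot>\<^bsub>C\<^esub> \<Sigma>) = fcell F \<Sigma>' \<cdot>\<^bsub>D\<^esub> fcell F \<Sigma>) \<and>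
    (\<forall>x y z. \<forall>\<beta> \<in> hom1 C x y. \<forall>\<alpha> \<in> hom1 C y z. \<forall>\<beta>' \<alpha>'.
       \<forall>\<Sigma> \<in> hom2 C \<beta> \<beta>'. \<forall>\<Sigma>' \<in> hom2 C \<alpha> \<alpha>'.
       fcell F (\<Sigma>' \<star>\<^bsub>C\<^esub> \<Sigma>) = fcell F \<Sigma>' \<star>\<^bsub>D\<^esub> fcell F \<Sigma>)"

record ('o, 'a, 't, 'p, 'b, 'u) transformation =
  tsrc :: "('o, 'a, 't, 'p, 'b, 'u) functor2"
  ttrg :: "('o, 'a, 't, 'p, 'b, 'u) functor2"
  tob :: "'o \<Rightarrow> 'b"
  tar :: "'a \<Rightarrow> 'u"

definition oplax_natural ::
  "('o, 'a, 't) two_cat \<Rightarrow> ('p, 'b, 'u) two_cat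
   \<Rightarrow> ('o, 'a, 't, 'p, 'b, 'u) functor2 \<Rightarrow> ('o, 'a, 't, 'p, 'b, 'u) functor2
   \<Rightarrow> ('o, 'a, 't, 'p, 'b, 'u) transformation \<Rightarrow> bool"
  where "oplax_natural C D F G \<rho> \<longleftrightarrow>
    strict_functor C D F \<and> strict_functor C D G \<and> tsrc \<rho> = F \<and> ttrg \<rho> = G \<and>
    tob \<rho> \<in> extensional (Obj C) \<and> tar \<rho> \<in> extensional (Arr C) \<and>
    (\<forall>x \<in> Obj C. tob \<rho> x \<in> hom1 D (fob F x) (fob G x)) \<and>
    (\<forall>x y. \<forall>\<alpha> \<in> hom1 C x y.
       tar \<rho> \<alpha> \<in> hom2 D (tob \<rho> y \<odot>\<^bsub>D\<^esub> far F \<alpha>) (far G \<alpha> \<odot>\<^bsub>D\<^esub> tob \<rho> x)) \<and>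
    (\<forall>x \<in> Obj C. tar \<rho> (Id1 C x) = Id2 D (tob \<rho> x)) \<and>
    (\<forall>x y z. \<forall>\<beta> \<in> hom1 C x y. \<forall>\<alpha> \<in> hom1 C y z.
       tar \<rho> (\<alpha> \<odot>\<^bsub>C\<^esub> \<beta>) = (far G \<alpha> \<triangleright>\<^bsub>D\<^esub> tar \<rho> \<beta>) \<cdot>\<^bsub>D\<^esub> (tar \<rho> \<alpha> \<triangleleft>\<^bsub>D\<^esub> far F \<beta>)) \<and>
    (\<forall>x y. \<forall>\<alpha> \<in> hom1 C x y. \<forall>\<gamma> \<in> hom1 C x y. \<forall>\<Sigma> \<in> hom2 C \<alpha> \<gamma>.
       (fcell G \<Sigma> \<triangleleft>\<^bsub>D\<^esub> tob \<rho> x) \<cdot>\<^bsub>D\<^esub> tar \<rho> \<alpha> = tar \<rho> \<gamma> \<cdot>\<^bsub>D\<^esub> (tob \<rho> y \<triangleright>\<^bsub>D\<^esub> fcell F \<Sigma>))"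

definition pseudo_natural ::
  "('o, 'a, 't) two_cat \<Rightarrow> ('p, 'b, 'u) two_cat
   \<Rightarrow> ('o, 'a, 't, 'p, 'b, 'u) functor2 \<Rightarrow> ('o, 'a, 't, 'p, 'b, 'u) functor2
   \<Rightarrow> ('o, 'a, 't, 'p, 'b, 'u) transformation \<Rightarrow> bool"
  where "pseudo_natural C D F G \<rho> \<longleftrightarrow>
    oplax_natural C D F G \<rho> \<and> (\<forall>\<alpha> \<in> Arr C. invertible2 D (tar \<rho> \<alpha>))"

definition id_transformation ::
  "('o, 'a, 't) two_cat \<Rightarrow> ('p, 'b, 'u) two_cat
   \<Rightarrow> ('o, 'a, 't, 'p, 'b, 'u) functor2 \<Rightarrow> ('o, 'a, 't, 'p, 'b, 'u) transformation"
  where "id_transformation C D F =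
    \<lparr>tsrc = F, ttrg = F, tob = (\<lambda>x \<in> Obj C. Id1 D (fob F x)),
     tar = (\<lambda>\<alpha> \<in> Arr C. Id2 D (far F \<alpha>))\<rparr>"

definition comp_transformation ::
  "('o, 'a, 't) two_cat \<Rightarrow> ('p, 'b, 'u) two_cat
   \<Rightarrow> ('o, 'a, 't, 'p, 'b, 'u) transformation \<Rightarrow> ('o, 'a, 't, 'p, 'b, 'u) transformation
   \<Rightarrow> ('o, 'a, 't, 'p, 'b, 'u) transformation"
  where "comp_transformation C D \<sigma> \<rho> =
    \<lparr>tsrc = tsrc \<rho>, ttrg = ttrg \<sigma>, tob = (\<lambda>x \<in> Obj C. tob \<sigma> x \<odot>\<^bsub>D\<^esub> tob \<rho> x),
     tar = (\<lambda>\<alpha> \<in> Arr C. (tar \<sigma> \<alpha> \<triangleleft>\<^bsub>D\<^esub> tob \<rho> (Dom C \<alpha>)) \<cdot>\<^bsub>D\<^esub> (tob \<sigma> (Cod C \<alpha>) \<triangleright>\<^bsub>D\<^esub> tar \<rho> \<alpha>))\<rparr>"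

record ('o, 'a, 't, 'p, 'b, 'u) modification =
  msrc :: "('o, 'a, 't, 'p, 'b, 'u) transformation"
  mtrg :: "('o, 'a, 't, 'p, 'b, 'u) transformation"
  mob :: "'o \<Rightarrow> 'u"

definition is_modification ::
  "('o, 'a, 't) two_cat \<Rightarrow> ('p, 'b, 'u) two_cat
   \<Rightarrow> ('o, 'a, 't, 'p, 'b, 'u) functor2 \<Rightarrow> ('o, 'a, 't, 'p, 'b, 'u) functor2
   \<Rightarrow> ('o, 'a, 't, 'p, 'b, 'u) transformation \<Rightarrow> ('o, 'a, 't, 'p, 'b, 'u) transformation
   \<Rightarrow> ('o, 'a, 't, 'p, 'b, 'u) modification \<Rightarrow> bool"
  where "is_modification C D F G \<sigma> \<rho> m \<longleftrightarrow>
    oplax_natural C D F G \<sigma> \<and> oplax_natural C D F G \<rho> \<and> msrc m = \<sigma> \<and> mtrg m = \<rho> \<and>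
    mob m \<in> extensional (Obj C) \<and>
    (\<forall>x \<in> Obj C. mob m x \<in> hom2 D (tob \<sigma> x) (tob \<rho> x)) \<and>
    (\<forall>x y. \<forall>\<alpha> \<in> hom1 C x y.
       tar \<rho> \<alpha> \<cdot>\<^bsub>D\<^esub> (mob m y \<triangleleft>\<^bsub>D\<^esub> far F \<alpha>) = (far G \<alpha> \<triangleright>\<^bsub>D\<^esub> mob m x) \<cdot>\<^bsub>D\<^esub> tar \<sigma> \<alpha>)"

text \<open>
  The 2-category of strict functors, oplax-natural transformations and modifications.
  Horizontal composition is componentwise, hence so is whiskering.
\<close>

definition Fun ::
  "('o, 'a, 't) two_cat \<Rightarrow> ('p, 'b, 'u) two_cat \<Rightarrow>
   (('o, 'a, 't, 'p, 'b, 'u) functor2, ('o, 'a, 't, 'p, 'b, 'u) transformation,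
    ('o, 'a, 't, 'p, 'b, 'u) modification) two_cat"
  where "Fun C D =
    \<lparr>Obj = {F. strict_functor C D F},
     Arr = {\<rho>. oplax_natural C D (tsrc \<rho>) (ttrg \<rho>) \<rho>},
     Cell = {m. is_modification C D (tsrc (msrc m)) (ttrg (msrc m)) (msrc m) (mtrg m) m},
     Dom = tsrc, Cod = ttrg, Src = msrc, Trg = mtrg,
     Id1 = id_transformation C D,
     Id2 = (\<lambda>\<rho>. \<lparr>msrc = \<rho>, mtrg = \<rho>, mob = (\<lambda>x \<in> Obj C. Id2 D (tob \<rho> x))\<rparr>),
     comp1 = comp_transformation C D,
     vcomp = (\<lambda>n m. \<lparr>msrc = msrc m, mtrg = mtrg n, mob = (\<lambda>x \<in> Obj C. mob n x \<cdot>\<^bsub>D\<^esub> mob m x)\<rparr>),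
     hcomp = (\<lambda>n m. \<lparr>msrc = comp_transformation C D (msrc n) (msrc m),
                      mtrg = comp_transformation C D (mtrg n) (mtrg m),
                      mob = (\<lambda>x \<in> Obj C. mob n x \<star>\<^bsub>D\<^esub> mob m x)\<rparr>)\<rparr>"

end

theory Submission
  imports Defs
begin

text \<open>
  For an adjunction \<open>(f, g, \<eta>, \<epsilon>)\<close> in a 2-category, transposition \<open>\<phi> \<mapsto> (g \<phi>) \<cdot> (\<eta> h)\<close> is a bijection from the
  cells \<open>f h \<Rightarrow> k\<close> to the cells \<open>h \<Rightarrow> g k\<close>. Componentwise adjunctions therefore determine \<open>\<sigma>(\<alpha>)\<close> as
  the cell with transpose \<open>(\<rho>(\<alpha>)\<inverse> \<sigma>(x)) \<cdot> (F(\<alpha>) \<eta>(x))\<close>, which says exactly that \<open>\<eta>\<close> is a modification.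
  Functoriality and naturality of \<open>\<sigma>\<close> and the modification law for \<open>\<epsilon>\<close> are equations between cells
  out of \<open>\<sigma>(y) h\<close>, so they may be checked on transposes, where they reduce to the laws for \<open>\<rho>\<inverse>\<close>.
\<close>

subsection \<open>Pasting in a 2-category\<close>

text \<open>The obstacle is the direction of \<rho>(\<alpha>) : \<rho>(y) G(\<alpha>) \<Rightarrow>
  F(\<alpha>) \<rho>(x). A cell \<sigma>(y) F(\<alpha>) \<Rightarrow> G(\<alpha>) \<sigma>(x)
  transposes to a cell F(\<alpha>) \<Rightarrow> \<rho>(y) G(\<alpha>) \<sigma>(x). The unit leads
  from F(\<alpha>) to F(\<alpha>) \<rho>(x) \<sigma>(x), and from there \<rho>(\<alpha>) points the
  wrong way; its inverse is what leads on to \<rho>(y) G(\<alpha>) \<sigma>(x). This is where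
  pseudo-naturality enters. Both inverse laws matter: cancelling \<rho>(\<alpha>) after its inverse
  gives the modification law of the unit, cancelling it before its inverse gives that of the counit.
  Uniqueness is an instance at \<open>Fun C D\<close> of a statement about an arbitrary 2-category,
  so \<open>Fun C D\<close> has to be shown to satisfy all the axioms; a large share of the text
  goes into this. In return, the zig-zag identities in \<open>Fun C D\<close> need no new argument,
  because equality of modifications with common source and target is decided componentwise.\<close>

text \<open>
  The simp rules below state composability through domains and codomains rather than hom-sets, so
  that the simplifier can discharge it. They rewrite a pasting diagram to a right-nested vertical
  composite of whiskered cells \<open>f \<triangleright> \<theta> \<triangleleft> g\<close>; only applications of the interchange law remain manual.
\<close>

context two_category
begin

lemma id1_simps [simp]:
  assumes "x \<in> Obj K"
  shows "Id1 K x \<in> Arr K" "Dom K (Id1 K x) = x" "Cod K (Id1 K x) = x"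
  using id1_hom [OF assms] by (auto simp: hom1_def)

lemma arr_simps [simp]:
  assumes "f \<in> Arr K"
  shows "Dom K f \<in> Obj K" "Cod K f \<in> Obj K"
  using arr_ends [OF assms] by auto

lemma cell_simps [simp]:
  assumes "\<theta> \<in> Cell K"
  shows "Src K \<theta> \<in> Arr K" "Trg K \<theta> \<in> Arr K"
    "Dom K (Trg K \<theta>) = Dom K (Src K \<theta>)" "Cod K (Trg K \<theta>) = Cod K (Src K \<theta>)"
  using cell_ends [OF assms] by auto

lemma comp1_simps [simp]:
  assumes "f \<in> Arr K" "g \<in> Arr K" "Dom K g = Cod K f"
  shows "g \<odot> f \<in> Arr K" "Dom K (g \<odot> f) = Dom K f" "Cod K (g \<odot> f) = Cod K g"
  using comp1_hom [of f _ _ g] assms by (auto simp: hom1_def)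

lemma comp1_assoc_simp [simp]:
  assumes "f \<in> Arr K" "g \<in> Arr K" "h \<in> Arr K" "Dom K g = Cod K f" "Dom K h = Cod K g"
  shows "(h \<odot> g) \<odot> f = h \<odot> (g \<odot> f)"
  using comp1_assoc assms by (auto simp: hom1_def)

lemma comp1_id_simps [simp]:
  assumes "f \<in> Arr K"
  shows "Cod K f = y \<Longrightarrow> Id1 K y \<odot> f = f" "Dom K f = x \<Longrightarrow> f \<odot> Id1 K x = f"
  using comp1_id assms by (auto simp: hom1_def)

lemma id2_simps [simp]:
  assumes "f \<in> Arr K"
  shows "Id2 K f \<in> Cell K" "Src K (Id2 K f) = f" "Trg K (Id2 K f) = f"
  using id2_hom [OF assms] by (auto simp: hom2_def)

lemma vcomp_simps [simp]:
  assumes "\<theta> \<in> Cell K" "\<tau> \<in> Cell K" "Src K \<tau> = Trg K \<theta>"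
  shows "\<tau> \<cdot> \<theta> \<in> Cell K" "Src K (\<tau> \<cdot> \<theta>) = Src K \<theta>" "Trg K (\<tau> \<cdot> \<theta>) = Trg K \<tau>"
  using vcomp_hom [of \<theta> _ _ \<tau>] assms by (auto simp: hom2_def)

lemma vcomp_assoc_simp [simp]:
  assumes "\<theta> \<in> Cell K" "\<tau> \<in> Cell K" "\<upsilon> \<in> Cell K" "Src K \<tau> = Trg K \<theta>" "Src K \<upsilon> = Trg K \<tau>"
  shows "(\<upsilon> \<cdot> \<tau>) \<cdot> \<theta> = \<upsilon> \<cdot> (\<tau> \<cdot> \<theta>)"
  using vcomp_assoc assms by (auto simp: hom2_def)

lemma vcomp_id_simps [simp]:
  assumes "\<theta> \<in> Cell K"
  shows "Trg K \<theta> = g \<Longrightarrow> Id2 K g \<cdot> \<theta> = \<theta>" "Src K \<theta> = f \<Longrightarrow> \<theta> \<cdot> Id2 K f = \<theta>"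
  using vcomp_id assms by (auto simp: hom2_def)

lemma hcomp_simps [simp]:
  assumes "\<theta> \<in> Cell K" "\<phi> \<in> Cell K" "Dom K (Src K \<phi>) = Cod K (Src K \<theta>)"
  shows "\<phi> \<star> \<theta> \<in> Cell K" "Src K (\<phi> \<star> \<theta>) = Src K \<phi> \<odot> Src K \<theta>"
    "Trg K (\<phi> \<star> \<theta>) = Trg K \<phi> \<odot> Trg K \<theta>"
  using hcomp_hom [of "Src K \<theta>" _ _ \<theta> "Trg K \<theta>" "Src K \<phi>" _ \<phi> "Trg K \<phi>"] assms
  by (auto simp: hom1_def hom2_def)

lemma hcomp_assoc_simp [simp]:
  assumes "\<theta> \<in> Cell K" "\<phi> \<in> Cell K" "\<psi> \<in> Cell K"
    "Dom K (Src K \<phi>) = Cod K (Src K \<theta>)" "Dom K (Src K \<psi>) = Cod K (Src K \<phi>)"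
  shows "(\<psi> \<star> \<phi>) \<star> \<theta> = \<psi> \<star> (\<phi> \<star> \<theta>)"
  using assms by (intro hcomp_assoc) (auto simp: hom1_def hom2_def)

lemma hcomp_unit_simps [simp]:
  assumes "\<theta> \<in> Cell K"
  shows "Cod K (Src K \<theta>) = y \<Longrightarrow> Id1 K y \<triangleright> \<theta> = \<theta>" "Dom K (Src K \<theta>) = x \<Longrightarrow> \<theta> \<triangleleft> Id1 K x = \<theta>"
  using hcomp_unit assms by (auto simp: hom1_def hom2_def)

lemma hcomp_id_simp [simp]:
  assumes "f \<in> Arr K" "g \<in> Arr K" "Dom K g = Cod K f"
  shows "Id2 K g \<star> Id2 K f = Id2 K (g \<odot> f)"
  using hcomp_id assms by (auto simp: hom1_def)

text \<open>Right-nesting by \<open>hcomp_assoc_simp\<close> separates two identity cells that stand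
  to the left of \<open>\<theta>\<close>, so \<open>hcomp_id_simp\<close> cannot merge them; this
  rule does. To the right of \<open>\<theta>\<close> the nesting itself brings them together, so no
  mirror image is stated.\<close>

lemma whiskerL_comp1 [simp]:
  assumes "\<theta> \<in> Cell K" "f \<in> Arr K" "g \<in> Arr K" "Dom K f = Cod K (Src K \<theta>)" "Dom K g = Cod K f"
  shows "g \<triangleright> (f \<triangleright> \<theta>) = (g \<odot> f) \<triangleright> \<theta>"
  using hcomp_assoc_simp [of \<theta> "Id2 K f" "Id2 K g"] assms by simp

lemma interchange_cells:
  assumes "\<theta> \<in> Cell K" "\<theta>' \<in> Cell K" "\<phi> \<in> Cell K" "\<phi>' \<in> Cell K" "Src K \<theta>' = Trg K \<theta>"
    "Src K \<phi>' = Trg K \<phi>" "Dom K (Src K \<phi>) = Cod K (Src K \<theta>)"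
  shows "(\<phi>' \<cdot> \<phi>) \<star> (\<theta>' \<cdot> \<theta>) = (\<phi>' \<star> \<theta>') \<cdot> (\<phi> \<star> \<theta>)"
  using assms by (intro interchange) (auto simp: hom1_def hom2_def)

lemma whiskerL_vcomp [simp]:
  assumes "\<theta> \<in> Cell K" "\<theta>' \<in> Cell K" "Src K \<theta>' = Trg K \<theta>" "g \<in> Arr K" "Dom K g = Cod K (Src K \<theta>)"
  shows "g \<triangleright> (\<theta>' \<cdot> \<theta>) = (g \<triangleright> \<theta>') \<cdot> (g \<triangleright> \<theta>)"
  using interchange_cells [of \<theta> \<theta>' "Id2 K g" "Id2 K g"] assms by simp

lemma whiskerR_vcomp [simp]:
  assumes "\<phi> \<in> Cell K" "\<phi>' \<in> Cell K" "Src K \<phi>' = Trg K \<phi>" "f \<in> Arr K" "Dom K (Src K \<phi>) = Cod K f"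
  shows "(\<phi>' \<cdot> \<phi>) \<triangleleft> f = (\<phi>' \<triangleleft> f) \<cdot> (\<phi> \<triangleleft> f)"
  using interchange_cells [of "Id2 K f" "Id2 K f" \<phi> \<phi>'] assms by simp

lemma hcomp_eq_whisker:
  assumes "\<theta> \<in> Cell K" "\<phi> \<in> Cell K" "Dom K (Src K \<phi>) = Cod K (Src K \<theta>)"
  shows "\<phi> \<star> \<theta> = (\<phi> \<triangleleft> Trg K \<theta>) \<cdot> (Src K \<phi> \<triangleright> \<theta>)"
  using interchange_cells [of \<theta> "Id2 K (Trg K \<theta>)" "Id2 K (Src K \<phi>)" \<phi>] assms by simp

text \<open>Both sides are the horizontal composite \<open>\<phi> \<star> \<theta>\<close>, computed
  by letting one or the other cell act first. It is the naturality of whiskering that lets cells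
  slide past each other in all later pasting arguments.\<close>

lemma exchange:
  assumes "\<theta> \<in> Cell K" "\<phi> \<in> Cell K" "Dom K (Src K \<phi>) = Cod K (Src K \<theta>)"
  shows "(Trg K \<phi> \<triangleright> \<theta>) \<cdot> (\<phi> \<triangleleft> Src K \<theta>) = (\<phi> \<triangleleft> Trg K \<theta>) \<cdot> (Src K \<phi> \<triangleright> \<theta>)"
  using interchange_cells [of "Id2 K (Src K \<theta>)" \<theta> \<phi> "Id2 K (Trg K \<phi>)"] hcomp_eq_whisker [OF assms] assms
  by simp

text \<open>With composites nested to the right, the two leading cells of a longer composite do not
  form a subterm, so an equation between two-cell composites cannot rewrite them directly. This rule
  supplies the rebracketing.\<close>

lemma vcomp_eq_extend:
  assumes "\<tau> \<cdot> \<theta> = \<tau>' \<cdot> \<theta>'" "\<xi> \<in> Cell K" "\<theta> \<in> Cell K" "\<tau> \<in> Cell K" "\<theta>' \<in> Cell K" "\<tau>' \<in> Cell K"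
    "Src K \<theta> = Trg K \<xi>" "Src K \<theta>' = Trg K \<xi>" "Src K \<tau> = Trg K \<theta>" "Src K \<tau>' = Trg K \<theta>'"
  shows "\<tau> \<cdot> (\<theta> \<cdot> \<xi>) = \<tau>' \<cdot> (\<theta>' \<cdot> \<xi>)"
  using assms vcomp_assoc_simp by metis

end

subsection \<open>Transposition along an adjunction\<close>

text \<open>The 1-morphism \<open>h\<close> is a separate argument because the source
  \<open>f \<odot> h\<close> of \<open>\<phi>\<close> does not determine it; likewise
  \<open>k\<close> in the inverse operation is not determined by the target
  \<open>g \<odot> k\<close>.\<close>

definition adj_transpose where
  "adj_transpose K g \<eta> h \<phi> = (g \<triangleright>\<^bsub>K\<^esub> \<phi>) \<cdot>\<^bsub>K\<^esub> (\<eta> \<triangleleft>\<^bsub>K\<^esub> h)"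

definition adj_untranspose where
  "adj_untranspose K f \<epsilon> k \<chi> = (\<epsilon> \<triangleleft>\<^bsub>K\<^esub> k) \<cdot>\<^bsub>K\<^esub> (f \<triangleright>\<^bsub>K\<^esub> \<chi>)"

locale two_cat_adjunction = two_category K for K :: "('o, 'a, 't) two_cat" (structure) +
  fixes x y f g \<eta> \<epsilon>
  assumes adj: "adjunction K x y f g \<eta> \<epsilon>"
begin

lemma adj_simps [simp]:
  "x \<in> Obj K" "y \<in> Obj K"
  "f \<in> Arr K" "Dom K f = x" "Cod K f = y" "g \<in> Arr K" "Dom K g = y" "Cod K g = x"
  "\<eta> \<in> Cell K" "Src K \<eta> = Id1 K x" "Trg K \<eta> = g \<odot> f"
  "\<epsilon> \<in> Cell K" "Src K \<epsilon> = f \<odot> g" "Trg K \<epsilon> = Id1 K y"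
  using adj by (auto simp: adjunction_def hom1_def hom2_def)

lemma zigzag: "(\<epsilon> \<triangleleft> f) \<cdot> (f \<triangleright> \<eta>) = Id2 K f" "(g \<triangleright> \<epsilon>) \<cdot> (\<eta> \<triangleleft> g) = Id2 K g"
  using adj by (auto simp: adjunction_def)

text \<open>The cell \<open>\<phi>\<close> slides outwards past the counit, and what remains behind
  it is the first zig-zag identity whiskered with \<open>h\<close>.\<close>

lemma untranspose_transpose:
  assumes [simp]: "h \<in> Arr K" "Cod K h = x" "\<phi> \<in> Cell K" "Src K \<phi> = f \<odot> h" "Trg K \<phi> = k" "k \<in> Arr K"
    and k: "Dom K k = Dom K h" "Cod K k = y"
  shows "adj_untranspose K f \<epsilon> k (adj_transpose K g \<eta> h \<phi>) = \<phi>"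
proof -
  note [simp] = k
  have "adj_untranspose K f \<epsilon> k (adj_transpose K g \<eta> h \<phi>)
      = (\<epsilon> \<triangleleft> k) \<cdot> ((f \<odot> g) \<triangleright> \<phi>) \<cdot> (f \<triangleright> \<eta> \<triangleleft> h)"
    by (simp add: adj_untranspose_def adj_transpose_def)
  also have "\<dots> = \<phi> \<cdot> (\<epsilon> \<triangleleft> f \<odot> h) \<cdot> (f \<triangleright> \<eta> \<triangleleft> h)"
    using exchange [of \<phi> \<epsilon>] by (intro vcomp_eq_extend) simp_all
  also have "(\<epsilon> \<triangleleft> f \<odot> h) \<cdot> (f \<triangleright> \<eta> \<triangleleft> h) = Id2 K (f \<odot> h)"
    using arg_cong [OF zigzag(1), of "\<lambda>t. t \<triangleleft> h"] by simp
  finally show ?thesis by simp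
qed

text \<open>Dually, \<open>\<chi>\<close> slides inwards past the unit and leaves the second zig-zag
  identity, whiskered with \<open>k\<close>, in front of it.\<close>

lemma transpose_untranspose:
  assumes [simp]: "k \<in> Arr K" "Cod K k = y" "\<chi> \<in> Cell K" "Src K \<chi> = h" "Trg K \<chi> = g \<odot> k" "h \<in> Arr K"
    and h: "Dom K h = Dom K k" "Cod K h = x"
  shows "adj_transpose K g \<eta> h (adj_untranspose K f \<epsilon> k \<chi>) = \<chi>"
proof -
  note [simp] = h
  have "adj_transpose K g \<eta> h (adj_untranspose K f \<epsilon> k \<chi>)
      = (g \<triangleright> \<epsilon> \<triangleleft> k) \<cdot> ((g \<odot> f) \<triangleright> \<chi>) \<cdot> (\<eta> \<triangleleft> h)"
    by (simp add: adj_untranspose_def adj_transpose_def)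
  also have "((g \<odot> f) \<triangleright> \<chi>) \<cdot> (\<eta> \<triangleleft> h) = (\<eta> \<triangleleft> g \<odot> k) \<cdot> \<chi>"
    using exchange [of \<chi> \<eta>] by simp
  \<comment> \<open>The zig-zag now consists of the two leading factors, so it is bracketed
    explicitly before being replaced.\<close>
  also have "(g \<triangleright> \<epsilon> \<triangleleft> k) \<cdot> (\<eta> \<triangleleft> g \<odot> k) \<cdot> \<chi> = ((g \<triangleright> \<epsilon> \<triangleleft> k) \<cdot> (\<eta> \<triangleleft> g \<odot> k)) \<cdot> \<chi>"
    by simp
  also have "(g \<triangleright> \<epsilon> \<triangleleft> k) \<cdot> (\<eta> \<triangleleft> g \<odot> k) = Id2 K (g \<odot> k)"
    using arg_cong [OF zigzag(2), of "\<lambda>t. t \<triangleleft> k"] by simp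
  finally show ?thesis by simp
qed

text \<open>A map with a left inverse is injective. The common target \<open>Trg K \<psi>\<close>
  plays the role of \<open>k\<close>; its endpoints are those of \<open>f \<odot> h\<close> because
  source and target of a cell are parallel.\<close>

lemma transpose_inject:
  assumes "adj_transpose K g \<eta> h \<phi> = adj_transpose K g \<eta> h \<psi>"
    and "h \<in> Arr K" "Cod K h = x" "\<phi> \<in> Cell K" "Src K \<phi> = f \<odot> h" "\<psi> \<in> Cell K" "Src K \<psi> = f \<odot> h"
    and "Trg K \<phi> = Trg K \<psi>"
  shows "\<phi> = \<psi>"
proof -
  have *: "Dom K (Trg K \<psi>) = Dom K h" "Cod K (Trg K \<psi>) = y"
    using assms by (simp_all only: cell_simps comp1_simps adj_simps)
  show ?thesis
    using untranspose_transpose [of h \<phi> "Trg K \<psi>"] untranspose_transpose [of h \<psi> "Trg K \<psi>"] assms *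
    by (metis cell_simps(2))
qed

end

section \<open>Uniqueness of left adjoints\<close>

context two_category
begin

lemma left_adjoint_comparison_cell:
  assumes "adjunction K x y f g \<eta> \<epsilon>" and "adjunction K x y f' g \<eta>' \<epsilon>'"
  shows "left_adjoint_comparison K f \<epsilon> f' \<eta>' \<in> hom2 K f f'"
proof -
  interpret A: two_cat_adjunction K x y f g \<eta> \<epsilon> by unfold_locales fact
  interpret B: two_cat_adjunction K x y f' g \<eta>' \<epsilon>' by unfold_locales fact
  show ?thesis by (simp add: left_adjoint_comparison_def hom2_def)
qed

text \<open>The comparison is by construction the untranspose of \<open>\<eta>'\<close> with
  \<open>h\<close> an identity and \<open>k = f'\<close>. Hence it is the unique cell
  \<open>f \<Rightarrow> f'\<close> that carries one unit to the other.\<close>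

lemma transpose_comparison:
  assumes "adjunction K x y f g \<eta> \<epsilon>" and "adjunction K x y f' g \<eta>' \<epsilon>'"
  shows "(g \<triangleright> left_adjoint_comparison K f \<epsilon> f' \<eta>') \<cdot> \<eta> = \<eta>'"
proof -
  interpret A: two_cat_adjunction K x y f g \<eta> \<epsilon> by unfold_locales fact
  interpret B: two_cat_adjunction K x y f' g \<eta>' \<epsilon>' by unfold_locales fact
  show ?thesis
    using A.transpose_untranspose [of f' \<eta>' "Id1 K x"]
    by (simp add: left_adjoint_comparison_def adj_transpose_def adj_untranspose_def)
qed

text \<open>The composite of the two comparisons carries \<open>\<eta>\<close> to
  \<open>\<eta>'\<close> and back to \<open>\<eta>\<close>, so it has the same transpose as the
  identity of \<open>f\<close>. Exchanging the two adjunctions gives the other inverse law.\<close>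

lemma left_adjoint_comparison_inverse:
  assumes "adjunction K x y f g \<eta> \<epsilon>" and "adjunction K x y f' g \<eta>' \<epsilon>'"
  shows "left_adjoint_comparison K f' \<epsilon>' f \<eta> \<cdot> left_adjoint_comparison K f \<epsilon> f' \<eta>' = Id2 K f"
    (is "?\<kappa>' \<cdot> ?\<kappa> = _")
proof -
  interpret A: two_cat_adjunction K x y f g \<eta> \<epsilon> by unfold_locales fact
  interpret B: two_cat_adjunction K x y f' g \<eta>' \<epsilon>' by unfold_locales fact
  have [simp]: "?\<kappa> \<in> Cell K" "Src K ?\<kappa> = f" "Trg K ?\<kappa> = f'"
    "?\<kappa>' \<in> Cell K" "Src K ?\<kappa>' = f'" "Trg K ?\<kappa>' = f"
    using left_adjoint_comparison_cell assms by (auto simp: hom2_def)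
  have "(g \<triangleright> (?\<kappa>' \<cdot> ?\<kappa>)) \<cdot> \<eta> = (g \<triangleright> ?\<kappa>') \<cdot> (g \<triangleright> ?\<kappa>) \<cdot> \<eta>"
    by simp
  also have "\<dots> = \<eta>"
    using transpose_comparison assms by simp
  finally have "adj_transpose K g \<eta> (Id1 K x) (?\<kappa>' \<cdot> ?\<kappa>) = adj_transpose K g \<eta> (Id1 K x) (Id2 K f)"
    by (simp add: adj_transpose_def)
  then show ?thesis
    by (rule A.transpose_inject) simp_all
qed

lemma left_adjoint_comparison_invertible:
  assumes "adjunction K x y f g \<eta> \<epsilon>" and "adjunction K x y f' g \<eta>' \<epsilon>'"
  shows "invertible2 K (left_adjoint_comparison K f \<epsilon> f' \<eta>')"
proof -
  have "left_adjoint_comparison K f \<epsilon> f' \<eta>' \<in> hom2 K f f'"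
    "left_adjoint_comparison K f' \<epsilon>' f \<eta> \<in> hom2 K f' f"
    using left_adjoint_comparison_cell assms by blast+
  then show ?thesis
    using left_adjoint_comparison_inverse [OF assms] left_adjoint_comparison_inverse [OF assms(2,1)]
    unfolding invertible2_def hom2_def by fastforce
qed

end

subsection \<open>The 2-category of functors\<close>

lemma strict_functor_simps:
  assumes "strict_functor C D F" and "two_category C"
  shows "x \<in> Obj C \<Longrightarrow> fob F x \<in> Obj D"
    and "\<alpha> \<in> Arr C \<Longrightarrow> far F \<alpha> \<in> Arr D"
    and "\<alpha> \<in> Arr C \<Longrightarrow> Dom D (far F \<alpha>) = fob F (Dom C \<alpha>)"
    and "\<alpha> \<in> Arr C \<Longrightarrow> Cod D (far F \<alpha>) = fob F (Cod C \<alpha>)"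
    and "\<Sigma> \<in> Cell C \<Longrightarrow> fcell F \<Sigma> \<in> Cell D"
    and "\<Sigma> \<in> Cell C \<Longrightarrow> Src D (fcell F \<Sigma>) = far F (Src C \<Sigma>)"
    and "\<Sigma> \<in> Cell C \<Longrightarrow> Trg D (fcell F \<Sigma>) = far F (Trg C \<Sigma>)"
    and "x \<in> Obj C \<Longrightarrow> far F (Id1 C x) = Id1 D (fob F x)"
    and "\<lbrakk>\<beta> \<in> Arr C; \<alpha> \<in> Arr C; Dom C \<alpha> = Cod C \<beta>\<rbrakk>
      \<Longrightarrow> far F (\<alpha> \<odot>\<^bsub>C\<^esub> \<beta>) = far F \<alpha> \<odot>\<^bsub>D\<^esub> far F \<beta>"
  using assms unfolding strict_functor_def hom1_def hom2_def by auto

text \<open>The functors \<open>F\<close> and \<open>G\<close> do not occur on the left of the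
  boundary equations, so the simplifier could not guess them. The rules are therefore made simp
  rules in each proof, as instances for the transformations at hand.\<close>

lemma oplax_natural_simps:
  assumes "oplax_natural C D F G \<rho>"
  shows "tsrc \<rho> = F" and "ttrg \<rho> = G"
    and "x \<in> Obj C \<Longrightarrow> tob \<rho> x \<in> Arr D"
    and "x \<in> Obj C \<Longrightarrow> Dom D (tob \<rho> x) = fob F x"
    and "x \<in> Obj C \<Longrightarrow> Cod D (tob \<rho> x) = fob G x"
    and "\<alpha> \<in> Arr C \<Longrightarrow> tar \<rho> \<alpha> \<in> Cell D"
    and "\<alpha> \<in> Arr C \<Longrightarrow> Src D (tar \<rho> \<alpha>) = tob \<rho> (Cod C \<alpha>) \<odot>\<^bsub>D\<^esub> far F \<alpha>"
    and "\<alpha> \<in> Arr C \<Longrightarrow> Trg D (tar \<rho> \<alpha>) = far G \<alpha> \<odot>\<^bsub>D\<^esub> tob \<rho> (Dom C \<alpha>)"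
    and "x \<in> Obj C \<Longrightarrow> tar \<rho> (Id1 C x) = Id2 D (tob \<rho> x)"
    and "\<lbrakk>\<beta> \<in> Arr C; \<alpha> \<in> Arr C; Dom C \<alpha> = Cod C \<beta>\<rbrakk> \<Longrightarrow>
      tar \<rho> (\<alpha> \<odot>\<^bsub>C\<^esub> \<beta>) = (far G \<alpha> \<triangleright>\<^bsub>D\<^esub> tar \<rho> \<beta>) \<cdot>\<^bsub>D\<^esub> (tar \<rho> \<alpha> \<triangleleft>\<^bsub>D\<^esub> far F \<beta>)"
  using assms unfolding oplax_natural_def hom1_def hom2_def by auto

lemma oplax_natural_functors:
  assumes "oplax_natural C D F G \<rho>"
  shows "strict_functor C D F" "strict_functor C D G"
  using assms unfolding oplax_natural_def by auto

lemma oplax_natural_extensional: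
  assumes "oplax_natural C D F G \<rho>"
  shows "tob \<rho> \<in> extensional (Obj C)" "tar \<rho> \<in> extensional (Arr C)"
  using assms unfolding oplax_natural_def by auto

lemma oplax_natural_square:
  assumes "oplax_natural C D F G \<rho>" "two_category C" "\<Sigma> \<in> Cell C"
  shows "(fcell G \<Sigma> \<triangleleft>\<^bsub>D\<^esub> tob \<rho> (Dom C (Src C \<Sigma>))) \<cdot>\<^bsub>D\<^esub> tar \<rho> (Src C \<Sigma>)
    = tar \<rho> (Trg C \<Sigma>) \<cdot>\<^bsub>D\<^esub> (tob \<rho> (Cod C (Src C \<Sigma>)) \<triangleright>\<^bsub>D\<^esub> fcell F \<Sigma>)"
proof -
  have "Src C \<Sigma> \<in> hom1 C (Dom C (Src C \<Sigma>)) (Cod C (Src C \<Sigma>))"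
    "Trg C \<Sigma> \<in> hom1 C (Dom C (Src C \<Sigma>)) (Cod C (Src C \<Sigma>))" "\<Sigma> \<in> hom2 C (Src C \<Sigma>) (Trg C \<Sigma>)"
    using two_category.cell_ends [OF assms(2,3)] assms(3) by (auto simp: hom1_def hom2_def)
  then show ?thesis
    using assms(1) unfolding oplax_natural_def by blast
qed

lemma oplax_naturalI:
  assumes "strict_functor C D F" "strict_functor C D G" "tsrc \<rho> = F" "ttrg \<rho> = G"
    and "tob \<rho> \<in> extensional (Obj C)" "tar \<rho> \<in> extensional (Arr C)"
    and "\<And>x. x \<in> Obj C \<Longrightarrow> tob \<rho> x \<in> Arr D"
    and "\<And>x. x \<in> Obj C \<Longrightarrow> Dom D (tob \<rho> x) = fob F x"
    and "\<And>x. x \<in> Obj C \<Longrightarrow> Cod D (tob \<rho> x) = fob G x"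
    and "\<And>\<alpha>. \<alpha> \<in> Arr C \<Longrightarrow> tar \<rho> \<alpha> \<in> Cell D"
    and "\<And>\<alpha>. \<alpha> \<in> Arr C \<Longrightarrow> Src D (tar \<rho> \<alpha>) = tob \<rho> (Cod C \<alpha>) \<odot>\<^bsub>D\<^esub> far F \<alpha>"
    and "\<And>\<alpha>. \<alpha> \<in> Arr C \<Longrightarrow> Trg D (tar \<rho> \<alpha>) = far G \<alpha> \<odot>\<^bsub>D\<^esub> tob \<rho> (Dom C \<alpha>)"
    and "\<And>x. x \<in> Obj C \<Longrightarrow> tar \<rho> (Id1 C x) = Id2 D (tob \<rho> x)"
    and "\<And>\<alpha> \<beta>. \<lbrakk>\<beta> \<in> Arr C; \<alpha> \<in> Arr C; Dom C \<alpha> = Cod C \<beta>\<rbrakk> \<Longrightarrow>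
      tar \<rho> (\<alpha> \<odot>\<^bsub>C\<^esub> \<beta>) = (far G \<alpha> \<triangleright>\<^bsub>D\<^esub> tar \<rho> \<beta>) \<cdot>\<^bsub>D\<^esub> (tar \<rho> \<alpha> \<triangleleft>\<^bsub>D\<^esub> far F \<beta>)"
    and "\<And>\<Sigma>. \<Sigma> \<in> Cell C \<Longrightarrow>
      (fcell G \<Sigma> \<triangleleft>\<^bsub>D\<^esub> tob \<rho> (Dom C (Src C \<Sigma>))) \<cdot>\<^bsub>D\<^esub> tar \<rho> (Src C \<Sigma>)
      = tar \<rho> (Trg C \<Sigma>) \<cdot>\<^bsub>D\<^esub> (tob \<rho> (Cod C (Src C \<Sigma>)) \<triangleright>\<^bsub>D\<^esub> fcell F \<Sigma>)"
  shows "oplax_natural C D F G \<rho>"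
  unfolding oplax_natural_def hom1_def hom2_def
  using assms by auto

lemma is_modification_simps:
  assumes "is_modification C D F G \<sigma> \<rho> m"
  shows "msrc m = \<sigma>" and "mtrg m = \<rho>"
    and "x \<in> Obj C \<Longrightarrow> mob m x \<in> Cell D"
    and "x \<in> Obj C \<Longrightarrow> Src D (mob m x) = tob \<sigma> x"
    and "x \<in> Obj C \<Longrightarrow> Trg D (mob m x) = tob \<rho> x"
  using assms unfolding is_modification_def hom2_def by auto

lemma is_modification_oplax:
  assumes "is_modification C D F G \<sigma> \<rho> m"
  shows "oplax_natural C D F G \<sigma>" "oplax_natural C D F G \<rho>"
  using assms unfolding is_modification_def by auto

lemma is_modification_extensional:
  "is_modification C D F G \<sigma> \<rho> m \<Longrightarrow> mob m \<in> extensional (Obj C)"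
  unfolding is_modification_def by auto

lemma is_modification_square:
  assumes "is_modification C D F G \<sigma> \<rho> m" "\<alpha> \<in> Arr C"
  shows "tar \<rho> \<alpha> \<cdot>\<^bsub>D\<^esub> (mob m (Cod C \<alpha>) \<triangleleft>\<^bsub>D\<^esub> far F \<alpha>)
    = (far G \<alpha> \<triangleright>\<^bsub>D\<^esub> mob m (Dom C \<alpha>)) \<cdot>\<^bsub>D\<^esub> tar \<sigma> \<alpha>"
  using assms unfolding is_modification_def hom1_def by auto

lemma is_modificationI:
  assumes "oplax_natural C D F G \<sigma>" "oplax_natural C D F G \<rho>" "msrc m = \<sigma>" "mtrg m = \<rho>"
    and "mob m \<in> extensional (Obj C)"
    and "\<And>x. x \<in> Obj C \<Longrightarrow> mob m x \<in> Cell D"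
    and "\<And>x. x \<in> Obj C \<Longrightarrow> Src D (mob m x) = tob \<sigma> x"
    and "\<And>x. x \<in> Obj C \<Longrightarrow> Trg D (mob m x) = tob \<rho> x"
    and "\<And>\<alpha>. \<alpha> \<in> Arr C \<Longrightarrow> tar \<rho> \<alpha> \<cdot>\<^bsub>D\<^esub> (mob m (Cod C \<alpha>) \<triangleleft>\<^bsub>D\<^esub> far F \<alpha>)
      = (far G \<alpha> \<triangleright>\<^bsub>D\<^esub> mob m (Dom C \<alpha>)) \<cdot>\<^bsub>D\<^esub> tar \<sigma> \<alpha>"
  shows "is_modification C D F G \<sigma> \<rho> m"
  using assms unfolding is_modification_def hom1_def hom2_def by auto

lemma id_transformation_simps [simp]:
  "tsrc (id_transformation C D F) = F" "ttrg (id_transformation C D F) = F"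
  "x \<in> Obj C \<Longrightarrow> tob (id_transformation C D F) x = Id1 D (fob F x)"
  "\<alpha> \<in> Arr C \<Longrightarrow> tar (id_transformation C D F) \<alpha> = Id2 D (far F \<alpha>)"
  by (simp_all add: id_transformation_def)

lemma comp_transformation_simps [simp]:
  "tsrc (comp_transformation C D \<sigma> \<rho>) = tsrc \<rho>" "ttrg (comp_transformation C D \<sigma> \<rho>) = ttrg \<sigma>"
  "x \<in> Obj C \<Longrightarrow> tob (comp_transformation C D \<sigma> \<rho>) x = tob \<sigma> x \<odot>\<^bsub>D\<^esub> tob \<rho> x"
  "\<alpha> \<in> Arr C \<Longrightarrow> tar (comp_transformation C D \<sigma> \<rho>) \<alpha>
    = (tar \<sigma> \<alpha> \<triangleleft>\<^bsub>D\<^esub> tob \<rho> (Dom C \<alpha>)) \<cdot>\<^bsub>D\<^esub> (tob \<sigma> (Cod C \<alpha>) \<triangleright>\<^bsub>D\<^esub> tar \<rho> \<alpha>)"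
  by (simp_all add: comp_transformation_def)

lemma transformation_extensional [simp]:
  "tob (id_transformation C D F) \<in> extensional (Obj C)"
  "tar (id_transformation C D F) \<in> extensional (Arr C)"
  "tob (comp_transformation C D \<sigma> \<rho>) \<in> extensional (Obj C)"
  "tar (comp_transformation C D \<sigma> \<rho>) \<in> extensional (Arr C)"
  by (simp_all add: id_transformation_def comp_transformation_def)

lemma Fun_simps [simp]:
  "Obj (Fun C D) = {F. strict_functor C D F}"
  "Arr (Fun C D) = {\<rho>. oplax_natural C D (tsrc \<rho>) (ttrg \<rho>) \<rho>}"
  "Cell (Fun C D) = {m. is_modification C D (tsrc (msrc m)) (ttrg (msrc m)) (msrc m) (mtrg m) m}"
  "Dom (Fun C D) = tsrc" "Cod (Fun C D) = ttrg" "Src (Fun C D) = msrc" "Trg (Fun C D) = mtrg"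
  "Id1 (Fun C D) = id_transformation C D"
  "Id2 (Fun C D) \<rho> = \<lparr>msrc = \<rho>, mtrg = \<rho>, mob = (\<lambda>x \<in> Obj C. Id2 D (tob \<rho> x))\<rparr>"
  "comp1 (Fun C D) = comp_transformation C D"
  "vcomp (Fun C D) n m
    = \<lparr>msrc = msrc m, mtrg = mtrg n, mob = (\<lambda>x \<in> Obj C. mob n x \<cdot>\<^bsub>D\<^esub> mob m x)\<rparr>"
  "hcomp (Fun C D) n m
    = \<lparr>msrc = comp_transformation C D (msrc n) (msrc m),
       mtrg = comp_transformation C D (mtrg n) (mtrg m),
       mob = (\<lambda>x \<in> Obj C. mob n x \<star>\<^bsub>D\<^esub> mob m x)\<rparr>"
  by (simp_all add: Fun_def)

lemma hom1_Fun: "hom1 (Fun C D) F G = {\<rho>. oplax_natural C D F G \<rho>}"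
  by (auto simp: hom1_def oplax_natural_simps)

lemma hom2_FunI:
  "is_modification C D F G \<rho> \<sigma> m \<Longrightarrow> m \<in> hom2 (Fun C D) \<rho> \<sigma>"
  using oplax_natural_simps(1,2) [OF is_modification_oplax(1) [of C D F G \<rho> \<sigma> m]]
  by (auto simp: hom2_def is_modification_simps(1,2) [of C D F G \<rho> \<sigma> m])

lemma hom2_FunD:
  "m \<in> hom2 (Fun C D) \<rho> \<sigma> \<Longrightarrow> \<rho> \<in> hom1 (Fun C D) F G \<Longrightarrow> is_modification C D F G \<rho> \<sigma> m"
  by (auto simp: hom1_def hom2_def)

lemma hom1_FunD: "\<rho> \<in> hom1 (Fun C D) F G \<Longrightarrow> oplax_natural C D F G \<rho>"
  by (simp add: hom1_Fun)

section \<open>Verification of the 2-category axioms for \<open>Fun C D\<close>\<close>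

locale two_categories = C: two_category C + D: two_category D
  for C :: "('o, 'a, 't) two_cat" and D :: "('p, 'b, 'u) two_cat"
begin

lemma transformation_eqI:
  assumes "oplax_natural C D F G \<rho>" "oplax_natural C D F G \<sigma>"
    and "\<And>x. x \<in> Obj C \<Longrightarrow> tob \<rho> x = tob \<sigma> x" "\<And>\<alpha>. \<alpha> \<in> Arr C \<Longrightarrow> tar \<rho> \<alpha> = tar \<sigma> \<alpha>"
  shows "\<rho> = \<sigma>"
proof -
  have "tob \<rho> = tob \<sigma>" "tar \<rho> = tar \<sigma>"
    using assms oplax_natural_extensional by (blast intro: extensionalityI)+
  then show ?thesis
    using assms(1,2) by (simp add: oplax_natural_simps)
qed

lemma modification_eqI:
  fixes m n :: "('o, 'a, 't, 'p, 'b, 'u) modification"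
  assumes "mob m \<in> extensional (Obj C)" "mob n \<in> extensional (Obj C)"
    and "msrc m = msrc n" "mtrg m = mtrg n" "\<And>x. x \<in> Obj C \<Longrightarrow> mob m x = mob n x"
  shows "m = n"
  using extensionalityI [of "mob m" "Obj C" "mob n"] assms by simp

lemma oplax_natural_id:
  assumes "strict_functor C D F"
  shows "oplax_natural C D F F (id_transformation C D F)"
proof -
  note [simp] = strict_functor_simps [OF assms C.two_category_axioms]
  show ?thesis
    by (rule oplax_naturalI) (simp_all add: assms)
qed

text \<open>On a composite \<alpha>\<beta> the two transformations contribute four cells. The middle
  two are whiskerings of \<sigma>(\<alpha>) and \<rho>(\<beta>), and sliding them past each other
  regroups the four by \<beta> and \<alpha>. Naturality pastes the square of \<sigma>, whiskered by
  \<rho>(x), to the square of \<rho>, whiskered by \<sigma>(y).\<close>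

lemma oplax_natural_comp:
  assumes \<rho>: "oplax_natural C D F G \<rho>" and \<sigma>: "oplax_natural C D G H \<sigma>"
  shows "oplax_natural C D F H (comp_transformation C D \<sigma> \<rho>)"
proof -
  note [simp] = oplax_natural_functors [OF \<rho>] oplax_natural_functors [OF \<sigma>]
  note [simp] = strict_functor_simps [OF oplax_natural_functors(1) [OF \<rho>] C.two_category_axioms]
    strict_functor_simps [OF oplax_natural_functors(1) [OF \<sigma>] C.two_category_axioms]
    strict_functor_simps [OF oplax_natural_functors(2) [OF \<sigma>] C.two_category_axioms]
    oplax_natural_simps [OF \<rho>] oplax_natural_simps [OF \<sigma>]
  have comp: "tar (comp_transformation C D \<sigma> \<rho>) (\<alpha> \<odot>\<^bsub>C\<^esub> \<beta>) =
      (far H \<alpha> \<triangleright>\<^bsub>D\<^esub> tar (comp_transformation C D \<sigma> \<rho>) \<beta>) \<cdot>\<^bsub>D\<^esub>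
      (tar (comp_transformation C D \<sigma> \<rho>) \<alpha> \<triangleleft>\<^bsub>D\<^esub> far F \<beta>)"
    if [simp]: "\<beta> \<in> Arr C" "\<alpha> \<in> Arr C" "Dom C \<alpha> = Cod C \<beta>" for \<alpha> \<beta>
  proof -
    let ?r = "tob \<sigma> (Cod C \<alpha>) \<triangleright>\<^bsub>D\<^esub> tar \<rho> \<alpha> \<triangleleft>\<^bsub>D\<^esub> far F \<beta>"
    have "(tar \<sigma> \<alpha> \<triangleleft>\<^bsub>D\<^esub> far G \<beta> \<odot>\<^bsub>D\<^esub> tob \<rho> (Dom C \<beta>)) \<cdot>\<^bsub>D\<^esub>
          ((tob \<sigma> (Cod C \<alpha>) \<odot>\<^bsub>D\<^esub> far G \<alpha>) \<triangleright>\<^bsub>D\<^esub> tar \<rho> \<beta>) \<cdot>\<^bsub>D\<^esub> ?r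
        = ((far H \<alpha> \<odot>\<^bsub>D\<^esub> tob \<sigma> (Cod C \<beta>)) \<triangleright>\<^bsub>D\<^esub> tar \<rho> \<beta>) \<cdot>\<^bsub>D\<^esub>
          (tar \<sigma> \<alpha> \<triangleleft>\<^bsub>D\<^esub> tob \<rho> (Cod C \<beta>) \<odot>\<^bsub>D\<^esub> far F \<beta>) \<cdot>\<^bsub>D\<^esub> ?r"
      using D.exchange [of "tar \<rho> \<beta>" "tar \<sigma> \<alpha>"] by (intro D.vcomp_eq_extend) simp_all
    then show ?thesis by simp
  qed
  have square: "(fcell H \<Sigma> \<triangleleft>\<^bsub>D\<^esub> tob (comp_transformation C D \<sigma> \<rho>) (Dom C (Src C \<Sigma>))) \<cdot>\<^bsub>D\<^esub>
      tar (comp_transformation C D \<sigma> \<rho>) (Src C \<Sigma>)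
    = tar (comp_transformation C D \<sigma> \<rho>) (Trg C \<Sigma>) \<cdot>\<^bsub>D\<^esub>
      (tob (comp_transformation C D \<sigma> \<rho>) (Cod C (Src C \<Sigma>)) \<triangleright>\<^bsub>D\<^esub> fcell F \<Sigma>)"
    if [simp]: "\<Sigma> \<in> Cell C" for \<Sigma>
  proof -
    let ?x = "Dom C (Src C \<Sigma>)" and ?y = "Cod C (Src C \<Sigma>)"
    have "(fcell H \<Sigma> \<triangleleft>\<^bsub>D\<^esub> tob \<sigma> ?x \<odot>\<^bsub>D\<^esub> tob \<rho> ?x) \<cdot>\<^bsub>D\<^esub>
        (tar \<sigma> (Src C \<Sigma>) \<triangleleft>\<^bsub>D\<^esub> tob \<rho> ?x) \<cdot>\<^bsub>D\<^esub> (tob \<sigma> ?y \<triangleright>\<^bsub>D\<^esub> tar \<rho> (Src C \<Sigma>))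
      = (tar \<sigma> (Trg C \<Sigma>) \<triangleleft>\<^bsub>D\<^esub> tob \<rho> ?x) \<cdot>\<^bsub>D\<^esub> (tob \<sigma> ?y \<triangleright>\<^bsub>D\<^esub> fcell G \<Sigma> \<triangleleft>\<^bsub>D\<^esub> tob \<rho> ?x) \<cdot>\<^bsub>D\<^esub>
        (tob \<sigma> ?y \<triangleright>\<^bsub>D\<^esub> tar \<rho> (Src C \<Sigma>))"
      using arg_cong [OF oplax_natural_square [OF \<sigma> C.two_category_axioms that], of "\<lambda>t. t \<triangleleft>\<^bsub>D\<^esub> tob \<rho> ?x"]
      by (intro D.vcomp_eq_extend) simp_all
    also have "(tob \<sigma> ?y \<triangleright>\<^bsub>D\<^esub> fcell G \<Sigma> \<triangleleft>\<^bsub>D\<^esub> tob \<rho> ?x) \<cdot>\<^bsub>D\<^esub> (tob \<sigma> ?y \<triangleright>\<^bsub>D\<^esub> tar \<rho> (Src C \<Sigma>))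
      = (tob \<sigma> ?y \<triangleright>\<^bsub>D\<^esub> tar \<rho> (Trg C \<Sigma>)) \<cdot>\<^bsub>D\<^esub> ((tob \<sigma> ?y \<odot>\<^bsub>D\<^esub> tob \<rho> ?y) \<triangleright>\<^bsub>D\<^esub> fcell F \<Sigma>)"
      using arg_cong [OF oplax_natural_square [OF \<rho> C.two_category_axioms that], of "\<lambda>t. tob \<sigma> ?y \<triangleright>\<^bsub>D\<^esub> t"]
      by simp
    finally show ?thesis by simp
  qed
  show ?thesis
    \<comment> \<open>The values of the composite stay folded in the first pass, so that
      \<open>comp\<close> and \<open>square\<close> match; the second pass unfolds them for the
      remaining boundary conditions.\<close>
    by (rule oplax_naturalI) (use comp square in \<open>simp_all del: comp_transformation_simps(3,4)\<close>, simp_all)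
qed

lemma comp_transformation_assoc:
  assumes o: "oplax_natural C D F G \<rho>" "oplax_natural C D G H \<sigma>" "oplax_natural C D H J \<tau>"
  shows "comp_transformation C D (comp_transformation C D \<tau> \<sigma>) \<rho>
    = comp_transformation C D \<tau> (comp_transformation C D \<sigma> \<rho>)"
proof -
  note [simp] = strict_functor_simps [OF oplax_natural_functors(1) [OF o(1)] C.two_category_axioms]
    strict_functor_simps [OF oplax_natural_functors(1) [OF o(2)] C.two_category_axioms]
    strict_functor_simps [OF oplax_natural_functors(1) [OF o(3)] C.two_category_axioms]
    strict_functor_simps [OF oplax_natural_functors(2) [OF o(3)] C.two_category_axioms]
    oplax_natural_simps [OF o(1)] oplax_natural_simps [OF o(2)] oplax_natural_simps [OF o(3)]
  show ?thesis
  proof (rule transformation_eqI)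
    show "oplax_natural C D F J (comp_transformation C D (comp_transformation C D \<tau> \<sigma>) \<rho>)"
      "oplax_natural C D F J (comp_transformation C D \<tau> (comp_transformation C D \<sigma> \<rho>))"
      using o by (blast intro: oplax_natural_comp)+
  qed simp_all
qed

lemma comp_transformation_id:
  assumes o: "oplax_natural C D F G \<rho>"
  shows "comp_transformation C D (id_transformation C D G) \<rho> = \<rho>"
    and "comp_transformation C D \<rho> (id_transformation C D F) = \<rho>"
proof -
  note [simp] = strict_functor_simps [OF oplax_natural_functors(1) [OF o] C.two_category_axioms]
    strict_functor_simps [OF oplax_natural_functors(2) [OF o] C.two_category_axioms]
    oplax_natural_simps [OF o]
  note i = oplax_natural_id [OF oplax_natural_functors(1) [OF o]]
    oplax_natural_id [OF oplax_natural_functors(2) [OF o]]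
  show "comp_transformation C D (id_transformation C D G) \<rho> = \<rho>"
    by (rule transformation_eqI [OF oplax_natural_comp [OF o i(2)] o]) simp_all
  show "comp_transformation C D \<rho> (id_transformation C D F) = \<rho>"
    by (rule transformation_eqI [OF oplax_natural_comp [OF i(1) o] o]) simp_all
qed

lemma is_modification_id:
  assumes "oplax_natural C D F G \<rho>"
  shows "is_modification C D F G \<rho> \<rho> (Id2 (Fun C D) \<rho>)"
proof -
  note [simp] = assms oplax_natural_simps [OF assms]
  note [simp] = strict_functor_simps [OF oplax_natural_functors(1) [OF assms] C.two_category_axioms]
    strict_functor_simps [OF oplax_natural_functors(2) [OF assms] C.two_category_axioms]
  show ?thesis
    by (rule is_modificationI) simp_all
qed

lemma is_modification_vcomp:
  assumes m: "is_modification C D F G \<rho> \<sigma> m" and n: "is_modification C D F G \<sigma> \<tau> n"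
  shows "is_modification C D F G \<rho> \<tau> (n \<cdot>\<^bsub>Fun C D\<^esub> m)"
proof -
  have F: "strict_functor C D F" "strict_functor C D G"
    using oplax_natural_functors [OF is_modification_oplax(1) [OF m]] by auto
  note [simp] = strict_functor_simps [OF F(1) C.two_category_axioms]
    strict_functor_simps [OF F(2) C.two_category_axioms]
    is_modification_simps [OF m] is_modification_simps [OF n] is_modification_oplax [OF m]
    is_modification_oplax [OF n] oplax_natural_simps [OF is_modification_oplax(1) [OF m]]
    oplax_natural_simps [OF is_modification_oplax(2) [OF m]]
    oplax_natural_simps [OF is_modification_oplax(2) [OF n]]
  have "tar \<tau> \<alpha> \<cdot>\<^bsub>D\<^esub> (mob n (Cod C \<alpha>) \<triangleleft>\<^bsub>D\<^esub> far F \<alpha>) \<cdot>\<^bsub>D\<^esub> (mob m (Cod C \<alpha>) \<triangleleft>\<^bsub>D\<^esub> far F \<alpha>)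
      = (far G \<alpha> \<triangleright>\<^bsub>D\<^esub> mob n (Dom C \<alpha>)) \<cdot>\<^bsub>D\<^esub> (far G \<alpha> \<triangleright>\<^bsub>D\<^esub> mob m (Dom C \<alpha>)) \<cdot>\<^bsub>D\<^esub> tar \<rho> \<alpha>"
    if [simp]: "\<alpha> \<in> Arr C" for \<alpha>
  proof -
    have "tar \<tau> \<alpha> \<cdot>\<^bsub>D\<^esub> (mob n (Cod C \<alpha>) \<triangleleft>\<^bsub>D\<^esub> far F \<alpha>) \<cdot>\<^bsub>D\<^esub> (mob m (Cod C \<alpha>) \<triangleleft>\<^bsub>D\<^esub> far F \<alpha>)
      = (far G \<alpha> \<triangleright>\<^bsub>D\<^esub> mob n (Dom C \<alpha>)) \<cdot>\<^bsub>D\<^esub> tar \<sigma> \<alpha> \<cdot>\<^bsub>D\<^esub> (mob m (Cod C \<alpha>) \<triangleleft>\<^bsub>D\<^esub> far F \<alpha>)"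
      by (rule D.vcomp_eq_extend [OF is_modification_square [OF n that]]) simp_all
    then show ?thesis
      by (simp add: is_modification_square [OF m that])
  qed
  then show ?thesis
    by (intro is_modificationI) simp_all
qed

text \<open>Once each \<open>mob n x \<star> mob m x\<close> is split into two whiskerings, the law
  is a four-step pasting: \<rho>'(\<alpha>) slides past n(y), the squares of m and then of n are
  applied, and m(x) slides past \<sigma>(\<alpha>).\<close>

lemma is_modification_hcomp:
  assumes m: "is_modification C D F G \<rho> \<rho>' m" and n: "is_modification C D G H \<sigma> \<sigma>' n"
  shows "is_modification C D F H (comp_transformation C D \<sigma> \<rho>) (comp_transformation C D \<sigma>' \<rho>')
    (n \<star>\<^bsub>Fun C D\<^esub> m)"
proof -
  note o = is_modification_oplax [OF m] is_modification_oplax [OF n]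
  note [simp] = strict_functor_simps [OF oplax_natural_functors(1) [OF o(1)] C.two_category_axioms]
    strict_functor_simps [OF oplax_natural_functors(2) [OF o(1)] C.two_category_axioms]
    strict_functor_simps [OF oplax_natural_functors(2) [OF o(3)] C.two_category_axioms]
    is_modification_simps [OF m] is_modification_simps [OF n]
    oplax_natural_comp [OF o(1,3)] oplax_natural_comp [OF o(2,4)]
    oplax_natural_simps [OF o(1)] oplax_natural_simps [OF o(2)]
    oplax_natural_simps [OF o(3)] oplax_natural_simps [OF o(4)]
  have "tar (comp_transformation C D \<sigma>' \<rho>') \<alpha> \<cdot>\<^bsub>D\<^esub> (mob (n \<star>\<^bsub>Fun C D\<^esub> m) (Cod C \<alpha>) \<triangleleft>\<^bsub>D\<^esub> far F \<alpha>)
      = (far H \<alpha> \<triangleright>\<^bsub>D\<^esub> mob (n \<star>\<^bsub>Fun C D\<^esub> m) (Dom C \<alpha>)) \<cdot>\<^bsub>D\<^esub> tar (comp_transformation C D \<sigma> \<rho>) \<alpha>"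
    if [simp]: "\<alpha> \<in> Arr C" for \<alpha>
  proof -
    let ?x = "Dom C \<alpha>" and ?y = "Cod C \<alpha>"
    have [simp]: "mob n x \<star>\<^bsub>D\<^esub> mob m x = (mob n x \<triangleleft>\<^bsub>D\<^esub> tob \<rho>' x) \<cdot>\<^bsub>D\<^esub> (tob \<sigma> x \<triangleright>\<^bsub>D\<^esub> mob m x)"
      if "x \<in> Obj C" for x
      using D.hcomp_eq_whisker [of "mob m x" "mob n x"] that by simp
    let ?m = "tob \<sigma> ?y \<triangleright>\<^bsub>D\<^esub> mob m ?y \<triangleleft>\<^bsub>D\<^esub> far F \<alpha>"
    have "(tob \<sigma>' ?y \<triangleright>\<^bsub>D\<^esub> tar \<rho>' \<alpha>) \<cdot>\<^bsub>D\<^esub> (mob n ?y \<triangleleft>\<^bsub>D\<^esub> tob \<rho>' ?y \<odot>\<^bsub>D\<^esub> far F \<alpha>) \<cdot>\<^bsub>D\<^esub> ?m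
      = (mob n ?y \<triangleleft>\<^bsub>D\<^esub> far G \<alpha> \<odot>\<^bsub>D\<^esub> tob \<rho>' ?x) \<cdot>\<^bsub>D\<^esub> (tob \<sigma> ?y \<triangleright>\<^bsub>D\<^esub> tar \<rho>' \<alpha>) \<cdot>\<^bsub>D\<^esub> ?m"
      using D.exchange [of "tar \<rho>' \<alpha>" "mob n ?y"] by (intro D.vcomp_eq_extend) simp_all
    also have "(tob \<sigma> ?y \<triangleright>\<^bsub>D\<^esub> tar \<rho>' \<alpha>) \<cdot>\<^bsub>D\<^esub> ?m
      = ((tob \<sigma> ?y \<odot>\<^bsub>D\<^esub> far G \<alpha>) \<triangleright>\<^bsub>D\<^esub> mob m ?x) \<cdot>\<^bsub>D\<^esub> (tob \<sigma> ?y \<triangleright>\<^bsub>D\<^esub> tar \<rho> \<alpha>)"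
      using arg_cong [OF is_modification_square [OF m that], of "\<lambda>t. tob \<sigma> ?y \<triangleright>\<^bsub>D\<^esub> t"] by simp
    finally have "tar (comp_transformation C D \<sigma>' \<rho>') \<alpha> \<cdot>\<^bsub>D\<^esub>
        (mob (n \<star>\<^bsub>Fun C D\<^esub> m) (Cod C \<alpha>) \<triangleleft>\<^bsub>D\<^esub> far F \<alpha>)
      = (tar \<sigma>' \<alpha> \<triangleleft>\<^bsub>D\<^esub> tob \<rho>' ?x) \<cdot>\<^bsub>D\<^esub> (mob n ?y \<triangleleft>\<^bsub>D\<^esub> far G \<alpha> \<odot>\<^bsub>D\<^esub> tob \<rho>' ?x) \<cdot>\<^bsub>D\<^esub>
        ((tob \<sigma> ?y \<odot>\<^bsub>D\<^esub> far G \<alpha>) \<triangleright>\<^bsub>D\<^esub> mob m ?x) \<cdot>\<^bsub>D\<^esub> (tob \<sigma> ?y \<triangleright>\<^bsub>D\<^esub> tar \<rho> \<alpha>)"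
      by simp
    also have "\<dots> = (far H \<alpha> \<triangleright>\<^bsub>D\<^esub> mob n ?x \<triangleleft>\<^bsub>D\<^esub> tob \<rho>' ?x) \<cdot>\<^bsub>D\<^esub> (tar \<sigma> \<alpha> \<triangleleft>\<^bsub>D\<^esub> tob \<rho>' ?x) \<cdot>\<^bsub>D\<^esub>
        ((tob \<sigma> ?y \<odot>\<^bsub>D\<^esub> far G \<alpha>) \<triangleright>\<^bsub>D\<^esub> mob m ?x) \<cdot>\<^bsub>D\<^esub> (tob \<sigma> ?y \<triangleright>\<^bsub>D\<^esub> tar \<rho> \<alpha>)"
      using arg_cong [OF is_modification_square [OF n that], of "\<lambda>t. t \<triangleleft>\<^bsub>D\<^esub> tob \<rho>' ?x"]
      by (intro D.vcomp_eq_extend) simp_all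
    also have "(tar \<sigma> \<alpha> \<triangleleft>\<^bsub>D\<^esub> tob \<rho>' ?x) \<cdot>\<^bsub>D\<^esub>
        ((tob \<sigma> ?y \<odot>\<^bsub>D\<^esub> far G \<alpha>) \<triangleright>\<^bsub>D\<^esub> mob m ?x) \<cdot>\<^bsub>D\<^esub> (tob \<sigma> ?y \<triangleright>\<^bsub>D\<^esub> tar \<rho> \<alpha>)
      = ((far H \<alpha> \<odot>\<^bsub>D\<^esub> tob \<sigma> ?x) \<triangleright>\<^bsub>D\<^esub> mob m ?x) \<cdot>\<^bsub>D\<^esub> (tar \<sigma> \<alpha> \<triangleleft>\<^bsub>D\<^esub> tob \<rho> ?x) \<cdot>\<^bsub>D\<^esub>
        (tob \<sigma> ?y \<triangleright>\<^bsub>D\<^esub> tar \<rho> \<alpha>)"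
      using D.exchange [of "mob m ?x" "tar \<sigma> \<alpha>"] by (intro D.vcomp_eq_extend) simp_all
    finally show ?thesis by simp
  qed
  then show ?thesis
    by (intro is_modificationI) (simp_all del: comp_transformation_simps(4))
qed

text \<open>This makes the general results on adjunctions available for \<open>Fun C D\<close>.
  Equations between modifications reduce to the same equations in \<open>D\<close> at each object.
  The recorded sources and targets must agree as well, which is why associativity and unit laws for
  composing transformations are used again in the axioms for horizontal composition.\<close>

lemma two_category_Fun: "two_category (Fun C D)"
proof (rule two_category.intro)
  fix f
  assume "f \<in> Arr (Fun C D)"
  then show "Dom (Fun C D) f \<in> Obj (Fun C D) \<and> Cod (Fun C D) f \<in> Obj (Fun C D)"
    by (simp add: oplax_natural_functors)
next
  fix m
  assume "m \<in> Cell (Fun C D)"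
  then have "is_modification C D (tsrc (msrc m)) (ttrg (msrc m)) (msrc m) (mtrg m) m"
    by simp
  note o = is_modification_oplax [OF this]
  then show "Src (Fun C D) m \<in> Arr (Fun C D) \<and> Trg (Fun C D) m \<in> Arr (Fun C D)
      \<and> Dom (Fun C D) (Src (Fun C D) m) = Dom (Fun C D) (Trg (Fun C D) m)
      \<and> Cod (Fun C D) (Src (Fun C D) m) = Cod (Fun C D) (Trg (Fun C D) m)"
    using oplax_natural_simps(1,2) [OF o(2)] by simp
next
  fix F
  assume "F \<in> Obj (Fun C D)"
  then show "Id1 (Fun C D) F \<in> hom1 (Fun C D) F F"
    by (simp add: hom1_Fun oplax_natural_id)
next
  fix \<rho> \<sigma> F G H
  assume "\<rho> \<in> hom1 (Fun C D) F G" "\<sigma> \<in> hom1 (Fun C D) G H"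
  then show "\<sigma> \<odot>\<^bsub>Fun C D\<^esub> \<rho> \<in> hom1 (Fun C D) F H"
    by (simp add: hom1_Fun oplax_natural_comp)
next
  fix \<rho> \<sigma> \<tau> F G H J
  assume "\<rho> \<in> hom1 (Fun C D) F G" "\<sigma> \<in> hom1 (Fun C D) G H" "\<tau> \<in> hom1 (Fun C D) H J"
  then have o: "oplax_natural C D F G \<rho>" "oplax_natural C D G H \<sigma>" "oplax_natural C D H J \<tau>"
    by (simp_all add: hom1_Fun)
  then show "(\<tau> \<odot>\<^bsub>Fun C D\<^esub> \<sigma>) \<odot>\<^bsub>Fun C D\<^esub> \<rho> = \<tau> \<odot>\<^bsub>Fun C D\<^esub> \<sigma> \<odot>\<^bsub>Fun C D\<^esub> \<rho>"
    by (simp add: comp_transformation_assoc)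
next
  fix \<rho> F G
  assume "\<rho> \<in> hom1 (Fun C D) F G"
  then have o: "oplax_natural C D F G \<rho>"
    by (simp add: hom1_Fun)
  then show "Id1 (Fun C D) G \<odot>\<^bsub>Fun C D\<^esub> \<rho> = \<rho> \<and> \<rho> \<odot>\<^bsub>Fun C D\<^esub> Id1 (Fun C D) F = \<rho>"
    by (simp add: comp_transformation_id)
next
  fix \<rho>
  assume "\<rho> \<in> Arr (Fun C D)"
  then have "oplax_natural C D (tsrc \<rho>) (ttrg \<rho>) \<rho>"
    by simp
  then show "Id2 (Fun C D) \<rho> \<in> hom2 (Fun C D) \<rho> \<rho>"
    by (blast intro: hom2_FunI is_modification_id)
next
  fix m n \<rho> \<sigma> \<tau>
  assume "m \<in> hom2 (Fun C D) \<rho> \<sigma>" "n \<in> hom2 (Fun C D) \<sigma> \<tau>"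
  then have m: "is_modification C D (tsrc \<rho>) (ttrg \<rho>) \<rho> \<sigma> m"
    and n: "is_modification C D (tsrc \<sigma>) (ttrg \<sigma>) \<sigma> \<tau> n"
    by (auto simp: hom2_def)
  \<comment> \<open>Membership in \<open>hom2\<close> types \<open>m\<close> by the functors
    recorded in \<open>\<rho>\<close> and \<open>n\<close> by those recorded in
    \<open>\<sigma>\<close>; these have to be identified before the cells can be composed.\<close>
  have "tsrc \<sigma> = tsrc \<rho>" "ttrg \<sigma> = ttrg \<rho>"
    using oplax_natural_simps(1,2) [OF is_modification_oplax(2) [OF m]] by simp_all
  with n have "is_modification C D (tsrc \<rho>) (ttrg \<rho>) \<sigma> \<tau> n"
    by simp
  from is_modification_vcomp [OF m this]
  show "n \<cdot>\<^bsub>Fun C D\<^esub> m \<in> hom2 (Fun C D) \<rho> \<tau>"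
    by (rule hom2_FunI)
next
  fix l m n \<rho> \<sigma> \<tau> \<upsilon>
  assume "l \<in> hom2 (Fun C D) \<rho> \<sigma>" "m \<in> hom2 (Fun C D) \<sigma> \<tau>" "n \<in> hom2 (Fun C D) \<tau> \<upsilon>"
  then have "is_modification C D (tsrc \<rho>) (ttrg \<rho>) \<rho> \<sigma> l"
    "is_modification C D (tsrc \<sigma>) (ttrg \<sigma>) \<sigma> \<tau> m" "is_modification C D (tsrc \<tau>) (ttrg \<tau>) \<tau> \<upsilon> n"
    by (auto simp: hom2_def)
  note [simp] = this [THEN is_modification_simps(1)] this [THEN is_modification_simps(2)]
    this [THEN is_modification_simps(3)] this [THEN is_modification_simps(4)]
    this [THEN is_modification_simps(5)]
  show "(n \<cdot>\<^bsub>Fun C D\<^esub> m) \<cdot>\<^bsub>Fun C D\<^esub> l = n \<cdot>\<^bsub>Fun C D\<^esub> m \<cdot>\<^bsub>Fun C D\<^esub> l"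
    by (rule modification_eqI) simp_all
next
  fix m \<rho> \<sigma>
  assume "m \<in> hom2 (Fun C D) \<rho> \<sigma>"
  then have m: "is_modification C D (tsrc \<rho>) (ttrg \<rho>) \<rho> \<sigma> m"
    by (auto simp: hom2_def)
  note [simp] = is_modification_simps [OF m] is_modification_extensional [OF m]
  have "Id2 (Fun C D) \<sigma> \<cdot>\<^bsub>Fun C D\<^esub> m = m" "m \<cdot>\<^bsub>Fun C D\<^esub> Id2 (Fun C D) \<rho> = m"
    by (rule modification_eqI; simp)+
  then show "Id2 (Fun C D) \<sigma> \<cdot>\<^bsub>Fun C D\<^esub> m = m \<and> m \<cdot>\<^bsub>Fun C D\<^esub> Id2 (Fun C D) \<rho> = m"
    by blast
next
  fix \<rho> \<rho>' \<sigma> \<sigma>' m n F G H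
  assume "\<rho> \<in> hom1 (Fun C D) F G" "m \<in> hom2 (Fun C D) \<rho> \<rho>'"
    "\<sigma> \<in> hom1 (Fun C D) G H" "n \<in> hom2 (Fun C D) \<sigma> \<sigma>'"
  then have "oplax_natural C D F G \<rho>" "is_modification C D F G \<rho> \<rho>' m"
    "oplax_natural C D G H \<sigma>" "is_modification C D G H \<sigma> \<sigma>' n"
    by (blast intro: hom1_FunD hom2_FunD)+
  then show "n \<star>\<^bsub>Fun C D\<^esub> m \<in> hom2 (Fun C D) (\<sigma> \<odot>\<^bsub>Fun C D\<^esub> \<rho>) (\<sigma>' \<odot>\<^bsub>Fun C D\<^esub> \<rho>')"
    \<comment> \<open>Only the composition of 1-morphisms is unfolded; the cell stays folded in
      order to match \<open>is_modification_hcomp\<close>.\<close>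
    unfolding Fun_simps(10) by (blast intro: hom2_FunI is_modification_hcomp)
next
  fix \<rho> \<rho>' \<sigma> \<sigma>' \<tau> \<tau>' l m n F G H J
  assume "\<rho> \<in> hom1 (Fun C D) F G" "l \<in> hom2 (Fun C D) \<rho> \<rho>'"
    "\<sigma> \<in> hom1 (Fun C D) G H" "m \<in> hom2 (Fun C D) \<sigma> \<sigma>'"
    "\<tau> \<in> hom1 (Fun C D) H J" "n \<in> hom2 (Fun C D) \<tau> \<tau>'"
  then have o: "oplax_natural C D F G \<rho>" "oplax_natural C D G H \<sigma>" "oplax_natural C D H J \<tau>"
    and m: "is_modification C D F G \<rho> \<rho>' l" "is_modification C D G H \<sigma> \<sigma>' m"
    "is_modification C D H J \<tau> \<tau>' n"
    by (blast intro: hom1_FunD hom2_FunD)+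
  note [simp] = m [THEN is_modification_simps(1)] m [THEN is_modification_simps(2)]
    m [THEN is_modification_simps(3)] m [THEN is_modification_simps(4)] m [THEN is_modification_simps(5)]
    oplax_natural_simps [OF o(1)] oplax_natural_simps [OF o(2)] oplax_natural_simps [OF o(3)]
  show "(n \<star>\<^bsub>Fun C D\<^esub> m) \<star>\<^bsub>Fun C D\<^esub> l = n \<star>\<^bsub>Fun C D\<^esub> m \<star>\<^bsub>Fun C D\<^esub> l"
  proof (rule modification_eqI)
    show "msrc ((n \<star>\<^bsub>Fun C D\<^esub> m) \<star>\<^bsub>Fun C D\<^esub> l) = msrc (n \<star>\<^bsub>Fun C D\<^esub> m \<star>\<^bsub>Fun C D\<^esub> l)"
      using comp_transformation_assoc [OF o] by simp
    show "mtrg ((n \<star>\<^bsub>Fun C D\<^esub> m) \<star>\<^bsub>Fun C D\<^esub> l) = mtrg (n \<star>\<^bsub>Fun C D\<^esub> m \<star>\<^bsub>Fun C D\<^esub> l)"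
      using comp_transformation_assoc [OF m [THEN is_modification_oplax(2)]] by simp
  qed simp_all
next
  fix \<rho> \<rho>' F G m
  assume "\<rho> \<in> hom1 (Fun C D) F G" "m \<in> hom2 (Fun C D) \<rho> \<rho>'"
  then have o: "oplax_natural C D F G \<rho>" and m: "is_modification C D F G \<rho> \<rho>' m"
    by (blast intro: hom1_FunD hom2_FunD)+
  note [simp] = is_modification_simps [OF m] is_modification_extensional [OF m]
    strict_functor_simps [OF oplax_natural_functors(1) [OF o] C.two_category_axioms]
    strict_functor_simps [OF oplax_natural_functors(2) [OF o] C.two_category_axioms]
    oplax_natural_simps [OF o] comp_transformation_id [OF o]
    comp_transformation_id [OF is_modification_oplax(2) [OF m]]
  have "Id1 (Fun C D) G \<triangleright>\<^bsub>Fun C D\<^esub> m = m" "m \<triangleleft>\<^bsub>Fun C D\<^esub> Id1 (Fun C D) F = m"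
    by (rule modification_eqI; simp)+
  then show "Id1 (Fun C D) G \<triangleright>\<^bsub>Fun C D\<^esub> m = m \<and> m \<triangleleft>\<^bsub>Fun C D\<^esub> Id1 (Fun C D) F = m"
    by blast
next
  fix \<rho> \<sigma> F G H
  assume "\<rho> \<in> hom1 (Fun C D) F G" "\<sigma> \<in> hom1 (Fun C D) G H"
  then have o: "oplax_natural C D F G \<rho>" "oplax_natural C D G H \<sigma>"
    by (simp_all add: hom1_Fun)
  then show "Id2 (Fun C D) \<sigma> \<star>\<^bsub>Fun C D\<^esub> Id2 (Fun C D) \<rho> = Id2 (Fun C D) (\<sigma> \<odot>\<^bsub>Fun C D\<^esub> \<rho>)"
    by (intro modification_eqI) (simp_all add: oplax_natural_simps [OF o(1)] oplax_natural_simps [OF o(2)])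
next
  fix \<rho> \<rho>' \<rho>'' \<sigma> \<sigma>' \<sigma>'' m m' n n' F G H
  assume "\<rho> \<in> hom1 (Fun C D) F G" "m \<in> hom2 (Fun C D) \<rho> \<rho>'" "m' \<in> hom2 (Fun C D) \<rho>' \<rho>''"
    "\<sigma> \<in> hom1 (Fun C D) G H" "n \<in> hom2 (Fun C D) \<sigma> \<sigma>'" "n' \<in> hom2 (Fun C D) \<sigma>' \<sigma>''"
  then have o: "oplax_natural C D F G \<rho>" "oplax_natural C D G H \<sigma>"
    and m: "is_modification C D F G \<rho> \<rho>' m" "is_modification C D G H \<sigma> \<sigma>' n"
    by (blast intro: hom1_FunD hom2_FunD)+
  with \<open>m' \<in> _\<close> \<open>n' \<in> _\<close> have m': "is_modification C D F G \<rho>' \<rho>'' m'" "is_modification C D G H \<sigma>' \<sigma>'' n'"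
    using m [THEN is_modification_oplax(2)] by (simp_all add: hom2_FunD hom1_Fun)
  note [simp] = is_modification_simps [OF m(1)] is_modification_simps [OF m(2)]
    is_modification_simps [OF m'(1)] is_modification_simps [OF m'(2)]
    oplax_natural_simps [OF o(1)] oplax_natural_simps [OF o(2)]
  show "(n' \<cdot>\<^bsub>Fun C D\<^esub> n) \<star>\<^bsub>Fun C D\<^esub> (m' \<cdot>\<^bsub>Fun C D\<^esub> m)
      = (n' \<star>\<^bsub>Fun C D\<^esub> m') \<cdot>\<^bsub>Fun C D\<^esub> (n \<star>\<^bsub>Fun C D\<^esub> m)"
    by (rule modification_eqI) (simp_all add: D.interchange_cells)
qed

end

subsection \<open>Adjunctions in the 2-category of functors\<close>

context two_categories
begin

text \<open>Evaluation at \<open>x\<close> preserves identities, vertical composition and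
  whiskering, so the zig-zag identities in \<open>D\<close> are the \<open>x\<close>-components of
  those in \<open>Fun C D\<close>.\<close>

lemma adjunction_Fun_component:
  assumes "adjunction (Fun C D) F G \<sigma> \<rho> \<eta> \<epsilon>" and x: "x \<in> Obj C"
  shows "adjunction D (fob F x) (fob G x) (tob \<sigma> x) (tob \<rho> x) (mob \<eta> x) (mob \<epsilon> x)"
proof -
  interpret A: two_cat_adjunction "Fun C D" F G \<sigma> \<rho> \<eta> \<epsilon>
    by (simp add: two_cat_adjunction_def two_cat_adjunction_axioms_def two_category_Fun assms(1))
  have o: "oplax_natural C D F G \<sigma>" "oplax_natural C D G F \<rho>"
    and m: "is_modification C D F F (id_transformation C D F) (comp_transformation C D \<rho> \<sigma>) \<eta>"
      "is_modification C D G G (comp_transformation C D \<sigma> \<rho>) (id_transformation C D G) \<epsilon>"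
    using A.adj_simps by simp_all
  have "fob F x \<in> Obj D" "fob G x \<in> Obj D"
    using oplax_natural_functors [OF o(1)] x
    by (blast intro: strict_functor_simps(1) C.two_category_axioms)+
  then show ?thesis
    using x arg_cong [OF A.zigzag(1), of "\<lambda>m. mob m x"] arg_cong [OF A.zigzag(2), of "\<lambda>m. mob m x"]
    by (simp add: adjunction_def hom1_def hom2_def oplax_natural_simps [OF o(1)]
        oplax_natural_simps [OF o(2)] is_modification_simps [OF m(1)] is_modification_simps [OF m(2)])
qed

text \<open>The zig-zag identities hold because they hold at each object. Their recorded source and
  target are composites of a transformation with an identity, which
  \<open>comp_transformation_id\<close> reduces to the transformation itself.\<close>

lemma adjunction_FunI:
  assumes o: "oplax_natural C D F G \<sigma>" "oplax_natural C D G F \<rho>"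
    and m: "is_modification C D F F (id_transformation C D F) (comp_transformation C D \<rho> \<sigma>) \<eta>"
      "is_modification C D G G (comp_transformation C D \<sigma> \<rho>) (id_transformation C D G) \<epsilon>"
    and adj: "\<And>x. x \<in> Obj C
      \<Longrightarrow> adjunction D (fob F x) (fob G x) (tob \<sigma> x) (tob \<rho> x) (mob \<eta> x) (mob \<epsilon> x)"
  shows "adjunction (Fun C D) F G \<sigma> \<rho> \<eta> \<epsilon>"
  unfolding adjunction_def
proof (intro conjI)
  note [simp] = is_modification_simps [OF m(1)] is_modification_simps [OF m(2)]
    comp_transformation_id [OF o(1)] comp_transformation_id [OF o(2)]
  show "F \<in> Obj (Fun C D)" "G \<in> Obj (Fun C D)"
    using oplax_natural_functors [OF o(1)] by simp_all
  show "\<sigma> \<in> hom1 (Fun C D) F G" "\<rho> \<in> hom1 (Fun C D) G F"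
    using o by (simp_all add: hom1_Fun)
  show "\<eta> \<in> hom2 (Fun C D) (Id1 (Fun C D) F) (\<rho> \<odot>\<^bsub>Fun C D\<^esub> \<sigma>)"
    "\<epsilon> \<in> hom2 (Fun C D) (\<sigma> \<odot>\<^bsub>Fun C D\<^esub> \<rho>) (Id1 (Fun C D) G)"
    using m by (simp_all add: hom2_FunI)
  show "(\<epsilon> \<triangleleft>\<^bsub>Fun C D\<^esub> \<sigma>) \<cdot>\<^bsub>Fun C D\<^esub> (\<sigma> \<triangleright>\<^bsub>Fun C D\<^esub> \<eta>) = Id2 (Fun C D) \<sigma>"
    "(\<rho> \<triangleright>\<^bsub>Fun C D\<^esub> \<epsilon>) \<cdot>\<^bsub>Fun C D\<^esub> (\<eta> \<triangleleft>\<^bsub>Fun C D\<^esub> \<rho>) = Id2 (Fun C D) \<rho>"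
    using adj by (auto intro!: modification_eqI simp: adjunction_def)
qed

end

section \<open>The left adjoint of a pseudo-natural transformation\<close>

locale pseudo_with_left_adjoints = two_categories C D
  for C :: "('o, 'a, 't) two_cat" and D :: "('p, 'b, 'u) two_cat" +
  fixes F G \<rho> s e c
  assumes pseudo: "pseudo_natural C D G F \<rho>"
    and adj: "x \<in> Obj C \<Longrightarrow> adjunction D (fob F x) (fob G x) (s x) (tob \<rho> x) (e x) (c x)"
begin

lemma oplax: "oplax_natural C D G F \<rho>"
  using pseudo by (simp add: pseudo_natural_def)

lemma functors: "strict_functor C D F" "strict_functor C D G"
  using oplax_natural_functors [OF oplax] by auto

lemmas functor_simps [simp] =
  strict_functor_simps [OF functors(1) C.two_category_axioms]
  strict_functor_simps [OF functors(2) C.two_category_axioms]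

lemmas rho_simps [simp] = oplax_natural_simps [OF oplax]

lemma component_adjunction:
  "x \<in> Obj C \<Longrightarrow> two_cat_adjunction D (fob F x) (fob G x) (s x) (tob \<rho> x) (e x) (c x)"
  by (simp add: two_cat_adjunction_def two_cat_adjunction_axioms_def D.two_category_axioms adj)

lemmas component_simps [simp] = two_cat_adjunction.adj_simps [OF component_adjunction]

lemmas component_zigzag = two_cat_adjunction.zigzag [OF component_adjunction]

text \<open>\<open>invertible2\<close> only asserts that an inverse exists. By
  \<open>rho_inv_unique\<close> the choice made here is immaterial.\<close>

definition rho_inv where
  "rho_inv \<alpha> = (SOME \<tau>. \<tau> \<in> hom2 D (Trg D (tar \<rho> \<alpha>)) (Src D (tar \<rho> \<alpha>)) \<and>
     \<tau> \<cdot>\<^bsub>D\<^esub> tar \<rho> \<alpha> = Id2 D (Src D (tar \<rho> \<alpha>)) \<and> tar \<rho> \<alpha> \<cdot>\<^bsub>D\<^esub> \<tau> = Id2 D (Trg D (tar \<rho> \<alpha>)))"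

lemma rho_inv_simps [simp]:
  assumes "\<alpha> \<in> Arr C"
  shows "rho_inv \<alpha> \<in> Cell D"
    and "Src D (rho_inv \<alpha>) = far F \<alpha> \<odot>\<^bsub>D\<^esub> tob \<rho> (Dom C \<alpha>)"
    and "Trg D (rho_inv \<alpha>) = tob \<rho> (Cod C \<alpha>) \<odot>\<^bsub>D\<^esub> far G \<alpha>"
    and "rho_inv \<alpha> \<cdot>\<^bsub>D\<^esub> tar \<rho> \<alpha> = Id2 D (tob \<rho> (Cod C \<alpha>) \<odot>\<^bsub>D\<^esub> far G \<alpha>)"
    and "tar \<rho> \<alpha> \<cdot>\<^bsub>D\<^esub> rho_inv \<alpha> = Id2 D (far F \<alpha> \<odot>\<^bsub>D\<^esub> tob \<rho> (Dom C \<alpha>))"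
proof -
  have "invertible2 D (tar \<rho> \<alpha>)"
    using pseudo assms by (simp add: pseudo_natural_def)
  then have "\<exists>\<tau>. \<tau> \<in> hom2 D (Trg D (tar \<rho> \<alpha>)) (Src D (tar \<rho> \<alpha>)) \<and>
      \<tau> \<cdot>\<^bsub>D\<^esub> tar \<rho> \<alpha> = Id2 D (Src D (tar \<rho> \<alpha>)) \<and> tar \<rho> \<alpha> \<cdot>\<^bsub>D\<^esub> \<tau> = Id2 D (Trg D (tar \<rho> \<alpha>))"
    unfolding invertible2_def by blast
  from someI_ex [OF this, folded rho_inv_def] assms
  show "rho_inv \<alpha> \<in> Cell D"
    and "Src D (rho_inv \<alpha>) = far F \<alpha> \<odot>\<^bsub>D\<^esub> tob \<rho> (Dom C \<alpha>)"
    and "Trg D (rho_inv \<alpha>) = tob \<rho> (Cod C \<alpha>) \<odot>\<^bsub>D\<^esub> far G \<alpha>"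
    and "rho_inv \<alpha> \<cdot>\<^bsub>D\<^esub> tar \<rho> \<alpha> = Id2 D (tob \<rho> (Cod C \<alpha>) \<odot>\<^bsub>D\<^esub> far G \<alpha>)"
    and "tar \<rho> \<alpha> \<cdot>\<^bsub>D\<^esub> rho_inv \<alpha> = Id2 D (far F \<alpha> \<odot>\<^bsub>D\<^esub> tob \<rho> (Dom C \<alpha>))"
    by (simp_all add: hom2_def)
qed

text \<open>A right inverse suffices, since the invertible cell \<rho>(\<alpha>) can be cancelled on
  the left. The laws for inverses of identities and composites are thus checked by a single
  multiplication.\<close>

lemma rho_inv_unique:
  assumes [simp]: "\<alpha> \<in> Arr C" "\<tau> \<in> Cell D" "Trg D \<tau> = tob \<rho> (Cod C \<alpha>) \<odot>\<^bsub>D\<^esub> far G \<alpha>"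
    and \<tau>: "tar \<rho> \<alpha> \<cdot>\<^bsub>D\<^esub> \<tau> = Id2 D (far F \<alpha> \<odot>\<^bsub>D\<^esub> tob \<rho> (Dom C \<alpha>))"
  shows "\<tau> = rho_inv \<alpha>"
proof -
  have "\<tau> = (rho_inv \<alpha> \<cdot>\<^bsub>D\<^esub> tar \<rho> \<alpha>) \<cdot>\<^bsub>D\<^esub> \<tau>"
    by simp
  also have "\<dots> = rho_inv \<alpha> \<cdot>\<^bsub>D\<^esub> (tar \<rho> \<alpha> \<cdot>\<^bsub>D\<^esub> \<tau>)"
    by (rule D.vcomp_assoc_simp) simp_all
  also have "\<dots> = rho_inv \<alpha>"
    by (simp add: \<tau>)
  finally show ?thesis .
qed

lemma rho_inv_id:
  assumes [simp]: "x \<in> Obj C"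
  shows "rho_inv (Id1 C x) = Id2 D (tob \<rho> x)"
  by (rule rho_inv_unique [symmetric]) simp_all

text \<open>The inverse of a vertical composite takes the inverses in reverse order:
  \<rho>(\<alpha>) cancels against its inverse first, which brings \<rho>(\<beta>) next to its
  own.\<close>

lemma rho_inv_comp:
  assumes [simp]: "\<beta> \<in> Arr C" "\<alpha> \<in> Arr C" "Dom C \<alpha> = Cod C \<beta>"
  shows "rho_inv (\<alpha> \<odot>\<^bsub>C\<^esub> \<beta>) = (rho_inv \<alpha> \<triangleleft>\<^bsub>D\<^esub> far G \<beta>) \<cdot>\<^bsub>D\<^esub> (far F \<alpha> \<triangleright>\<^bsub>D\<^esub> rho_inv \<beta>)"
proof (rule rho_inv_unique [symmetric])
  have "(tar \<rho> \<alpha> \<triangleleft>\<^bsub>D\<^esub> far G \<beta>) \<cdot>\<^bsub>D\<^esub> (rho_inv \<alpha> \<triangleleft>\<^bsub>D\<^esub> far G \<beta>) \<cdot>\<^bsub>D\<^esub> (far F \<alpha> \<triangleright>\<^bsub>D\<^esub> rho_inv \<beta>)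
      = ((tar \<rho> \<alpha> \<cdot>\<^bsub>D\<^esub> rho_inv \<alpha>) \<triangleleft>\<^bsub>D\<^esub> far G \<beta>) \<cdot>\<^bsub>D\<^esub> (far F \<alpha> \<triangleright>\<^bsub>D\<^esub> rho_inv \<beta>)"
    \<comment> \<open>The cancellation rule is withheld so that whiskering first distributes over
      the bracketed product; the next step then cancels.\<close>
    by (simp del: rho_inv_simps(5))
  also have "\<dots> = far F \<alpha> \<triangleright>\<^bsub>D\<^esub> rho_inv \<beta>"
    by simp
  finally show "tar \<rho> (\<alpha> \<odot>\<^bsub>C\<^esub> \<beta>) \<cdot>\<^bsub>D\<^esub> (rho_inv \<alpha> \<triangleleft>\<^bsub>D\<^esub> far G \<beta>) \<cdot>\<^bsub>D\<^esub> (far F \<alpha> \<triangleright>\<^bsub>D\<^esub> rho_inv \<beta>)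
      = Id2 D (far F (\<alpha> \<odot>\<^bsub>C\<^esub> \<beta>) \<odot>\<^bsub>D\<^esub> tob \<rho> (Dom C (\<alpha> \<odot>\<^bsub>C\<^esub> \<beta>)))"
    using arg_cong [OF rho_inv_simps(5) [OF assms(1)], of "\<lambda>t. far F \<alpha> \<triangleright>\<^bsub>D\<^esub> t"]
    by (simp del: rho_inv_simps(5))
qed simp_all

text \<open>Naturality of \<rho> conjugated by inverses: the inverse at the target of \<Sigma>
  followed back by \<rho> there is inserted in front, the square of \<rho> is applied, and \<rho>
  cancels at the source of \<Sigma>.\<close>

lemma rho_inv_square:
  assumes [simp]: "\<Sigma> \<in> Cell C"
  shows "(tob \<rho> (Cod C (Src C \<Sigma>)) \<triangleright>\<^bsub>D\<^esub> fcell G \<Sigma>) \<cdot>\<^bsub>D\<^esub> rho_inv (Src C \<Sigma>)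
    = rho_inv (Trg C \<Sigma>) \<cdot>\<^bsub>D\<^esub> (fcell F \<Sigma> \<triangleleft>\<^bsub>D\<^esub> tob \<rho> (Dom C (Src C \<Sigma>)))"
    (is "?g \<cdot>\<^bsub>D\<^esub> ?r = ?r' \<cdot>\<^bsub>D\<^esub> ?f")
proof -
  have "?g \<cdot>\<^bsub>D\<^esub> ?r = (?r' \<cdot>\<^bsub>D\<^esub> tar \<rho> (Trg C \<Sigma>)) \<cdot>\<^bsub>D\<^esub> ?g \<cdot>\<^bsub>D\<^esub> ?r"
    by simp
  also have "\<dots> = ?r' \<cdot>\<^bsub>D\<^esub> tar \<rho> (Trg C \<Sigma>) \<cdot>\<^bsub>D\<^esub> ?g \<cdot>\<^bsub>D\<^esub> ?r"
    by (simp del: rho_inv_simps(4))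
  also have "tar \<rho> (Trg C \<Sigma>) \<cdot>\<^bsub>D\<^esub> ?g \<cdot>\<^bsub>D\<^esub> ?r = ?f \<cdot>\<^bsub>D\<^esub> tar \<rho> (Src C \<Sigma>) \<cdot>\<^bsub>D\<^esub> ?r"
    by (rule D.vcomp_eq_extend [OF oplax_natural_square [OF oplax C.two_category_axioms assms, symmetric]])
      simp_all
  finally show ?thesis by simp
qed

text \<open>This is the mate of \<open>rho_inv \<alpha>\<close> in the usual sense, pasted from the
  unit at the domain of \<alpha> and the counit at its codomain.\<close>

definition mate where
  "mate \<alpha> = adj_untranspose D (s (Cod C \<alpha>)) (c (Cod C \<alpha>)) (far G \<alpha> \<odot>\<^bsub>D\<^esub> s (Dom C \<alpha>))
     ((rho_inv \<alpha> \<triangleleft>\<^bsub>D\<^esub> s (Dom C \<alpha>)) \<cdot>\<^bsub>D\<^esub> (far F \<alpha> \<triangleright>\<^bsub>D\<^esub> e (Dom C \<alpha>)))"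

lemma mate_simps [simp]:
  assumes [simp]: "\<alpha> \<in> Arr C"
  shows "mate \<alpha> \<in> Cell D"
    and "Src D (mate \<alpha>) = s (Cod C \<alpha>) \<odot>\<^bsub>D\<^esub> far F \<alpha>"
    and "Trg D (mate \<alpha>) = far G \<alpha> \<odot>\<^bsub>D\<^esub> s (Dom C \<alpha>)"
  by (simp_all add: mate_def adj_untranspose_def)

text \<open>The characterising equation of the mate. Apart from the boundaries, all further
  properties are derived from it, without returning to the formula that contains the counit.\<close>

lemma transpose_mate:
  assumes [simp]: "\<alpha> \<in> Arr C"
  shows "(tob \<rho> (Cod C \<alpha>) \<triangleright>\<^bsub>D\<^esub> mate \<alpha>) \<cdot>\<^bsub>D\<^esub> (e (Cod C \<alpha>) \<triangleleft>\<^bsub>D\<^esub> far F \<alpha>)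
    = (rho_inv \<alpha> \<triangleleft>\<^bsub>D\<^esub> s (Dom C \<alpha>)) \<cdot>\<^bsub>D\<^esub> (far F \<alpha> \<triangleright>\<^bsub>D\<^esub> e (Dom C \<alpha>))"
  unfolding mate_def adj_transpose_def [symmetric]
  by (rule two_cat_adjunction.transpose_untranspose [OF component_adjunction]) simp_all

lemma mate_eqI:
  assumes "y \<in> Obj C" "h \<in> Arr D" "Cod D h = fob F y" "\<phi> \<in> Cell D" "Src D \<phi> = s y \<odot>\<^bsub>D\<^esub> h"
    "\<psi> \<in> Cell D" "Src D \<psi> = s y \<odot>\<^bsub>D\<^esub> h" "Trg D \<phi> = Trg D \<psi>"
    and "(tob \<rho> y \<triangleright>\<^bsub>D\<^esub> \<phi>) \<cdot>\<^bsub>D\<^esub> (e y \<triangleleft>\<^bsub>D\<^esub> h) = (tob \<rho> y \<triangleright>\<^bsub>D\<^esub> \<psi>) \<cdot>\<^bsub>D\<^esub> (e y \<triangleleft>\<^bsub>D\<^esub> h)"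
  shows "\<phi> = \<psi>"
  using assms two_cat_adjunction.transpose_inject [OF component_adjunction]
  unfolding adj_transpose_def by blast

lemma mate_id:
  assumes [simp]: "x \<in> Obj C"
  shows "mate (Id1 C x) = Id2 D (s x)"
  by (rule mate_eqI [of x "Id1 D (fob F x)"])
    (use transpose_mate [of "Id1 C x"] in \<open>simp_all add: rho_inv_id\<close>)

text \<open>On transposes: the mate of \<alpha> turns into \<open>rho_inv \<alpha>\<close>, the mate
  of \<beta> slides inwards past it to meet the unit at the middle object, and there it turns into
  \<open>rho_inv \<beta>\<close>. The outcome is the transpose prescribed by
  \<open>rho_inv_comp\<close>.\<close>

lemma mate_comp:
  assumes [simp]: "\<beta> \<in> Arr C" "\<alpha> \<in> Arr C" "Dom C \<alpha> = Cod C \<beta>"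
  shows "mate (\<alpha> \<odot>\<^bsub>C\<^esub> \<beta>) = (far G \<alpha> \<triangleright>\<^bsub>D\<^esub> mate \<beta>) \<cdot>\<^bsub>D\<^esub> (mate \<alpha> \<triangleleft>\<^bsub>D\<^esub> far F \<beta>)"
proof (rule mate_eqI [of "Cod C \<alpha>" "far F \<alpha> \<odot>\<^bsub>D\<^esub> far F \<beta>"])
  let ?x = "Dom C \<beta>" and ?y = "Cod C \<beta>" and ?z = "Cod C \<alpha>"
  have "(tob \<rho> ?z \<triangleright>\<^bsub>D\<^esub> mate \<alpha> \<triangleleft>\<^bsub>D\<^esub> far F \<beta>) \<cdot>\<^bsub>D\<^esub> (e ?z \<triangleleft>\<^bsub>D\<^esub> far F \<alpha> \<odot>\<^bsub>D\<^esub> far F \<beta>)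
      = (rho_inv \<alpha> \<triangleleft>\<^bsub>D\<^esub> s ?y \<odot>\<^bsub>D\<^esub> far F \<beta>) \<cdot>\<^bsub>D\<^esub> (far F \<alpha> \<triangleright>\<^bsub>D\<^esub> e ?y \<triangleleft>\<^bsub>D\<^esub> far F \<beta>)"
    using arg_cong [OF transpose_mate [of \<alpha>], of "\<lambda>t. t \<triangleleft>\<^bsub>D\<^esub> far F \<beta>"] by simp
  then have "(tob \<rho> ?z \<triangleright>\<^bsub>D\<^esub> ((far G \<alpha> \<triangleright>\<^bsub>D\<^esub> mate \<beta>) \<cdot>\<^bsub>D\<^esub> (mate \<alpha> \<triangleleft>\<^bsub>D\<^esub> far F \<beta>))) \<cdot>\<^bsub>D\<^esub>
        (e ?z \<triangleleft>\<^bsub>D\<^esub> far F \<alpha> \<odot>\<^bsub>D\<^esub> far F \<beta>)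
      = ((tob \<rho> ?z \<odot>\<^bsub>D\<^esub> far G \<alpha>) \<triangleright>\<^bsub>D\<^esub> mate \<beta>) \<cdot>\<^bsub>D\<^esub> (rho_inv \<alpha> \<triangleleft>\<^bsub>D\<^esub> s ?y \<odot>\<^bsub>D\<^esub> far F \<beta>) \<cdot>\<^bsub>D\<^esub>
        (far F \<alpha> \<triangleright>\<^bsub>D\<^esub> e ?y \<triangleleft>\<^bsub>D\<^esub> far F \<beta>)"
    by simp
  also have "\<dots> = (rho_inv \<alpha> \<triangleleft>\<^bsub>D\<^esub> far G \<beta> \<odot>\<^bsub>D\<^esub> s ?x) \<cdot>\<^bsub>D\<^esub> ((far F \<alpha> \<odot>\<^bsub>D\<^esub> tob \<rho> ?y) \<triangleright>\<^bsub>D\<^esub> mate \<beta>) \<cdot>\<^bsub>D\<^esub>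
        (far F \<alpha> \<triangleright>\<^bsub>D\<^esub> e ?y \<triangleleft>\<^bsub>D\<^esub> far F \<beta>)"
    using D.exchange [of "mate \<beta>" "rho_inv \<alpha>"] by (intro D.vcomp_eq_extend) simp_all
  also have "((far F \<alpha> \<odot>\<^bsub>D\<^esub> tob \<rho> ?y) \<triangleright>\<^bsub>D\<^esub> mate \<beta>) \<cdot>\<^bsub>D\<^esub> (far F \<alpha> \<triangleright>\<^bsub>D\<^esub> e ?y \<triangleleft>\<^bsub>D\<^esub> far F \<beta>)
      = (far F \<alpha> \<triangleright>\<^bsub>D\<^esub> rho_inv \<beta> \<triangleleft>\<^bsub>D\<^esub> s ?x) \<cdot>\<^bsub>D\<^esub> ((far F \<alpha> \<odot>\<^bsub>D\<^esub> far F \<beta>) \<triangleright>\<^bsub>D\<^esub> e ?x)"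
    using arg_cong [OF transpose_mate [of \<beta>], of "\<lambda>t. far F \<alpha> \<triangleright>\<^bsub>D\<^esub> t"] by simp
  finally show "(tob \<rho> ?z \<triangleright>\<^bsub>D\<^esub> mate (\<alpha> \<odot>\<^bsub>C\<^esub> \<beta>)) \<cdot>\<^bsub>D\<^esub> (e ?z \<triangleleft>\<^bsub>D\<^esub> far F \<alpha> \<odot>\<^bsub>D\<^esub> far F \<beta>)
      = (tob \<rho> ?z \<triangleright>\<^bsub>D\<^esub> ((far G \<alpha> \<triangleright>\<^bsub>D\<^esub> mate \<beta>) \<cdot>\<^bsub>D\<^esub> (mate \<alpha> \<triangleleft>\<^bsub>D\<^esub> far F \<beta>))) \<cdot>\<^bsub>D\<^esub>
        (e ?z \<triangleleft>\<^bsub>D\<^esub> far F \<alpha> \<odot>\<^bsub>D\<^esub> far F \<beta>)"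
    using transpose_mate [of "\<alpha> \<odot>\<^bsub>C\<^esub> \<beta>"] by (simp add: rho_inv_comp)
qed simp_all

text \<open>On transposes, \<open>rho_inv_square\<close> trades G(\<Sigma>) for F(\<Sigma>), which
  slides past the unit at x. The equation \<open>transpose_mate\<close> for the target of \<Sigma>,
  read backwards, restores a mate, and F(\<Sigma>) then slides past the unit at y into
  position.\<close>

lemma mate_square:
  assumes [simp]: "\<Sigma> \<in> Cell C"
  shows "(fcell G \<Sigma> \<triangleleft>\<^bsub>D\<^esub> s (Dom C (Src C \<Sigma>))) \<cdot>\<^bsub>D\<^esub> mate (Src C \<Sigma>)
    = mate (Trg C \<Sigma>) \<cdot>\<^bsub>D\<^esub> (s (Cod C (Src C \<Sigma>)) \<triangleright>\<^bsub>D\<^esub> fcell F \<Sigma>)"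
proof (rule mate_eqI [of "Cod C (Src C \<Sigma>)" "far F (Src C \<Sigma>)"])
  let ?x = "Dom C (Src C \<Sigma>)" and ?y = "Cod C (Src C \<Sigma>)" and ?\<alpha> = "Src C \<Sigma>" and ?\<gamma> = "Trg C \<Sigma>"
  have "(tob \<rho> ?y \<triangleright>\<^bsub>D\<^esub> ((fcell G \<Sigma> \<triangleleft>\<^bsub>D\<^esub> s ?x) \<cdot>\<^bsub>D\<^esub> mate ?\<alpha>)) \<cdot>\<^bsub>D\<^esub> (e ?y \<triangleleft>\<^bsub>D\<^esub> far F ?\<alpha>)
      = (tob \<rho> ?y \<triangleright>\<^bsub>D\<^esub> fcell G \<Sigma> \<triangleleft>\<^bsub>D\<^esub> s ?x) \<cdot>\<^bsub>D\<^esub> (rho_inv ?\<alpha> \<triangleleft>\<^bsub>D\<^esub> s ?x) \<cdot>\<^bsub>D\<^esub> (far F ?\<alpha> \<triangleright>\<^bsub>D\<^esub> e ?x)"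
    by (simp add: transpose_mate)
  also have "\<dots> = (rho_inv ?\<gamma> \<triangleleft>\<^bsub>D\<^esub> s ?x) \<cdot>\<^bsub>D\<^esub> (fcell F \<Sigma> \<triangleleft>\<^bsub>D\<^esub> tob \<rho> ?x \<odot>\<^bsub>D\<^esub> s ?x) \<cdot>\<^bsub>D\<^esub> (far F ?\<alpha> \<triangleright>\<^bsub>D\<^esub> e ?x)"
    using arg_cong [OF rho_inv_square [OF assms], of "\<lambda>t. t \<triangleleft>\<^bsub>D\<^esub> s ?x"]
    by (intro D.vcomp_eq_extend) simp_all
  also have "(fcell F \<Sigma> \<triangleleft>\<^bsub>D\<^esub> tob \<rho> ?x \<odot>\<^bsub>D\<^esub> s ?x) \<cdot>\<^bsub>D\<^esub> (far F ?\<alpha> \<triangleright>\<^bsub>D\<^esub> e ?x)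
      = (far F ?\<gamma> \<triangleright>\<^bsub>D\<^esub> e ?x) \<cdot>\<^bsub>D\<^esub> fcell F \<Sigma>"
    using D.exchange [of "e ?x" "fcell F \<Sigma>"] by simp
  also have "(rho_inv ?\<gamma> \<triangleleft>\<^bsub>D\<^esub> s ?x) \<cdot>\<^bsub>D\<^esub> (far F ?\<gamma> \<triangleright>\<^bsub>D\<^esub> e ?x) \<cdot>\<^bsub>D\<^esub> fcell F \<Sigma>
      = (tob \<rho> ?y \<triangleright>\<^bsub>D\<^esub> mate ?\<gamma>) \<cdot>\<^bsub>D\<^esub> (e ?y \<triangleleft>\<^bsub>D\<^esub> far F ?\<gamma>) \<cdot>\<^bsub>D\<^esub> fcell F \<Sigma>"
    using transpose_mate [of ?\<gamma>] by (intro D.vcomp_eq_extend) simp_all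
  also have "(e ?y \<triangleleft>\<^bsub>D\<^esub> far F ?\<gamma>) \<cdot>\<^bsub>D\<^esub> fcell F \<Sigma>
      = ((tob \<rho> ?y \<odot>\<^bsub>D\<^esub> s ?y) \<triangleright>\<^bsub>D\<^esub> fcell F \<Sigma>) \<cdot>\<^bsub>D\<^esub> (e ?y \<triangleleft>\<^bsub>D\<^esub> far F ?\<alpha>)"
    using D.exchange [of "fcell F \<Sigma>" "e ?y"] by simp
  finally show "(tob \<rho> ?y \<triangleright>\<^bsub>D\<^esub> ((fcell G \<Sigma> \<triangleleft>\<^bsub>D\<^esub> s ?x) \<cdot>\<^bsub>D\<^esub> mate ?\<alpha>)) \<cdot>\<^bsub>D\<^esub> (e ?y \<triangleleft>\<^bsub>D\<^esub> far F ?\<alpha>)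
      = (tob \<rho> ?y \<triangleright>\<^bsub>D\<^esub> (mate ?\<gamma> \<cdot>\<^bsub>D\<^esub> (s ?y \<triangleright>\<^bsub>D\<^esub> fcell F \<Sigma>))) \<cdot>\<^bsub>D\<^esub> (e ?y \<triangleleft>\<^bsub>D\<^esub> far F ?\<alpha>)"
    by simp
qed simp_all

text \<open>This is \<open>transpose_mate\<close> followed by \<rho>(\<alpha>), which cancels its
  inverse. The left side contains the value of \<rho>\<sigma> at \<alpha>, so it is the modification
  law for the unit without the identity cell.\<close>

lemma unit_square:
  assumes [simp]: "\<alpha> \<in> Arr C"
  shows "(tar \<rho> \<alpha> \<triangleleft>\<^bsub>D\<^esub> s (Dom C \<alpha>)) \<cdot>\<^bsub>D\<^esub> (tob \<rho> (Cod C \<alpha>) \<triangleright>\<^bsub>D\<^esub> mate \<alpha>) \<cdot>\<^bsub>D\<^esub> (e (Cod C \<alpha>) \<triangleleft>\<^bsub>D\<^esub> far F \<alpha>)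
    = far F \<alpha> \<triangleright>\<^bsub>D\<^esub> e (Dom C \<alpha>)"
proof -
  let ?x = "Dom C \<alpha>"
  have "(tar \<rho> \<alpha> \<triangleleft>\<^bsub>D\<^esub> s ?x) \<cdot>\<^bsub>D\<^esub> (rho_inv \<alpha> \<triangleleft>\<^bsub>D\<^esub> s ?x) \<cdot>\<^bsub>D\<^esub> (far F \<alpha> \<triangleright>\<^bsub>D\<^esub> e ?x)
      = ((tar \<rho> \<alpha> \<cdot>\<^bsub>D\<^esub> rho_inv \<alpha>) \<triangleleft>\<^bsub>D\<^esub> s ?x) \<cdot>\<^bsub>D\<^esub> (far F \<alpha> \<triangleright>\<^bsub>D\<^esub> e ?x)"
    by (simp del: rho_inv_simps(5))
  then show ?thesis
    by (simp add: transpose_mate)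
qed

text \<open>Transposed along the adjunction at y, the left side is an identity by the second
  zig-zag. On the right, \<rho>(\<alpha>) slides past the unit at y, the mate becomes
  \<open>rho_inv \<alpha>\<close>, the counit at x slides past that cell, and the zig-zag at x
  collapses. What remains is \<rho>(\<alpha>) followed by its inverse, again an identity.\<close>

lemma counit_square:
  assumes [simp]: "\<alpha> \<in> Arr C"
  shows "c (Cod C \<alpha>) \<triangleleft>\<^bsub>D\<^esub> far G \<alpha>
    = (far G \<alpha> \<triangleright>\<^bsub>D\<^esub> c (Dom C \<alpha>)) \<cdot>\<^bsub>D\<^esub> (mate \<alpha> \<triangleleft>\<^bsub>D\<^esub> tob \<rho> (Dom C \<alpha>)) \<cdot>\<^bsub>D\<^esub> (s (Cod C \<alpha>) \<triangleright>\<^bsub>D\<^esub> tar \<rho> \<alpha>)"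
    (is "_ = ?rhs")
proof (rule mate_eqI [of "Cod C \<alpha>" "tob \<rho> (Cod C \<alpha>) \<odot>\<^bsub>D\<^esub> far G \<alpha>"])
  let ?x = "Dom C \<alpha>" and ?y = "Cod C \<alpha>"
  have "(tob \<rho> ?y \<triangleright>\<^bsub>D\<^esub> ?rhs) \<cdot>\<^bsub>D\<^esub> (e ?y \<triangleleft>\<^bsub>D\<^esub> tob \<rho> ?y \<odot>\<^bsub>D\<^esub> far G \<alpha>)
      = ((tob \<rho> ?y \<odot>\<^bsub>D\<^esub> far G \<alpha>) \<triangleright>\<^bsub>D\<^esub> c ?x) \<cdot>\<^bsub>D\<^esub> (tob \<rho> ?y \<triangleright>\<^bsub>D\<^esub> mate \<alpha> \<triangleleft>\<^bsub>D\<^esub> tob \<rho> ?x) \<cdot>\<^bsub>D\<^esub>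
        ((tob \<rho> ?y \<odot>\<^bsub>D\<^esub> s ?y) \<triangleright>\<^bsub>D\<^esub> tar \<rho> \<alpha>) \<cdot>\<^bsub>D\<^esub> (e ?y \<triangleleft>\<^bsub>D\<^esub> tob \<rho> ?y \<odot>\<^bsub>D\<^esub> far G \<alpha>)"
    by simp
  also have "((tob \<rho> ?y \<odot>\<^bsub>D\<^esub> s ?y) \<triangleright>\<^bsub>D\<^esub> tar \<rho> \<alpha>) \<cdot>\<^bsub>D\<^esub> (e ?y \<triangleleft>\<^bsub>D\<^esub> tob \<rho> ?y \<odot>\<^bsub>D\<^esub> far G \<alpha>)
      = (e ?y \<triangleleft>\<^bsub>D\<^esub> far F \<alpha> \<odot>\<^bsub>D\<^esub> tob \<rho> ?x) \<cdot>\<^bsub>D\<^esub> tar \<rho> \<alpha>"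
    using D.exchange [of "tar \<rho> \<alpha>" "e ?y"] by simp
  also have "(tob \<rho> ?y \<triangleright>\<^bsub>D\<^esub> mate \<alpha> \<triangleleft>\<^bsub>D\<^esub> tob \<rho> ?x) \<cdot>\<^bsub>D\<^esub> (e ?y \<triangleleft>\<^bsub>D\<^esub> far F \<alpha> \<odot>\<^bsub>D\<^esub> tob \<rho> ?x) \<cdot>\<^bsub>D\<^esub> tar \<rho> \<alpha>
      = (rho_inv \<alpha> \<triangleleft>\<^bsub>D\<^esub> s ?x \<odot>\<^bsub>D\<^esub> tob \<rho> ?x) \<cdot>\<^bsub>D\<^esub> (far F \<alpha> \<triangleright>\<^bsub>D\<^esub> e ?x \<triangleleft>\<^bsub>D\<^esub> tob \<rho> ?x) \<cdot>\<^bsub>D\<^esub> tar \<rho> \<alpha>"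
    using arg_cong [OF transpose_mate [of \<alpha>], of "\<lambda>t. t \<triangleleft>\<^bsub>D\<^esub> tob \<rho> ?x"]
    by (intro D.vcomp_eq_extend) simp_all
  also have "((tob \<rho> ?y \<odot>\<^bsub>D\<^esub> far G \<alpha>) \<triangleright>\<^bsub>D\<^esub> c ?x) \<cdot>\<^bsub>D\<^esub> (rho_inv \<alpha> \<triangleleft>\<^bsub>D\<^esub> s ?x \<odot>\<^bsub>D\<^esub> tob \<rho> ?x) \<cdot>\<^bsub>D\<^esub>
        (far F \<alpha> \<triangleright>\<^bsub>D\<^esub> e ?x \<triangleleft>\<^bsub>D\<^esub> tob \<rho> ?x) \<cdot>\<^bsub>D\<^esub> tar \<rho> \<alpha>
      = rho_inv \<alpha> \<cdot>\<^bsub>D\<^esub> ((far F \<alpha> \<odot>\<^bsub>D\<^esub> tob \<rho> ?x) \<triangleright>\<^bsub>D\<^esub> c ?x) \<cdot>\<^bsub>D\<^esub>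
        (far F \<alpha> \<triangleright>\<^bsub>D\<^esub> e ?x \<triangleleft>\<^bsub>D\<^esub> tob \<rho> ?x) \<cdot>\<^bsub>D\<^esub> tar \<rho> \<alpha>"
    using D.exchange [of "c ?x" "rho_inv \<alpha>"] by (intro D.vcomp_eq_extend) simp_all
  also have "((far F \<alpha> \<odot>\<^bsub>D\<^esub> tob \<rho> ?x) \<triangleright>\<^bsub>D\<^esub> c ?x) \<cdot>\<^bsub>D\<^esub> (far F \<alpha> \<triangleright>\<^bsub>D\<^esub> e ?x \<triangleleft>\<^bsub>D\<^esub> tob \<rho> ?x) \<cdot>\<^bsub>D\<^esub> tar \<rho> \<alpha>
      = (far F \<alpha> \<triangleright>\<^bsub>D\<^esub> ((tob \<rho> ?x \<triangleright>\<^bsub>D\<^esub> c ?x) \<cdot>\<^bsub>D\<^esub> (e ?x \<triangleleft>\<^bsub>D\<^esub> tob \<rho> ?x))) \<cdot>\<^bsub>D\<^esub> tar \<rho> \<alpha>"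
    by simp
  also have "\<dots> = tar \<rho> \<alpha>"
    by (subst component_zigzag) simp_all
  finally show "(tob \<rho> ?y \<triangleright>\<^bsub>D\<^esub> (c ?y \<triangleleft>\<^bsub>D\<^esub> far G \<alpha>)) \<cdot>\<^bsub>D\<^esub> (e ?y \<triangleleft>\<^bsub>D\<^esub> tob \<rho> ?y \<odot>\<^bsub>D\<^esub> far G \<alpha>)
      = (tob \<rho> ?y \<triangleright>\<^bsub>D\<^esub> ?rhs) \<cdot>\<^bsub>D\<^esub> (e ?y \<triangleleft>\<^bsub>D\<^esub> tob \<rho> ?y \<odot>\<^bsub>D\<^esub> far G \<alpha>)"
    using arg_cong [OF component_zigzag(2) [of ?y], of "\<lambda>t. t \<triangleleft>\<^bsub>D\<^esub> far G \<alpha>"] by simp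
qed simp_all

text \<open>Outside the carriers \<open>s\<close> and \<open>mate\<close> have arbitrary values,
  whereas transformations are required to be extensional; hence the restrictions, here and for the
  unit and counit.\<close>

definition sigma where
  "sigma = \<lparr>tsrc = F, ttrg = G, tob = restrict s (Obj C), tar = restrict mate (Arr C)\<rparr>"

lemma sigma_simps [simp]:
  "tsrc sigma = F" "ttrg sigma = G"
  "x \<in> Obj C \<Longrightarrow> tob sigma x = s x" "\<alpha> \<in> Arr C \<Longrightarrow> tar sigma \<alpha> = mate \<alpha>"
  by (simp_all add: sigma_def)

lemma oplax_natural_sigma: "oplax_natural C D F G sigma"
  by (rule oplax_naturalI)
    (simp_all add: functors mate_id mate_comp mate_square, simp_all add: sigma_def)

definition unit where
  "unit = \<lparr>msrc = id_transformation C D F, mtrg = comp_transformation C D \<rho> sigma,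
     mob = restrict e (Obj C)\<rparr>"

definition counit where
  "counit = \<lparr>msrc = comp_transformation C D sigma \<rho>, mtrg = id_transformation C D G,
     mob = restrict c (Obj C)\<rparr>"

lemma is_modification_unit:
  "is_modification C D F F (id_transformation C D F) (comp_transformation C D \<rho> sigma) unit"
  unfolding unit_def
  by (rule is_modificationI)
    (simp_all add: functors oplax_natural_id oplax_natural_comp [OF oplax_natural_sigma oplax] unit_square)

lemma is_modification_counit:
  "is_modification C D G G (comp_transformation C D sigma \<rho>) (id_transformation C D G) counit"
  unfolding counit_def
  by (rule is_modificationI)
    (simp_all add: functors oplax_natural_id oplax_natural_comp [OF oplax oplax_natural_sigma]
      \<comment> \<open>The identity cell of the target transformation drops out, and the longer
        side is rewritten to the single whiskered counit.\<close>
      flip: counit_square)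

lemma adjunction_sigma: "adjunction (Fun C D) F G sigma \<rho> unit counit"
  by (rule adjunction_FunI [OF oplax_natural_sigma oplax is_modification_unit is_modification_counit])
    (simp add: adj unit_def counit_def)

end

theorem propositionB31:
  fixes C :: "('o, 'a, 't) two_cat" and D :: "('p, 'b, 'u) two_cat"
  assumes "two_category C" and "two_category D"
  shows
    "(\<forall>F G \<sigma> \<rho> \<eta> \<epsilon>. F \<in> Obj (Fun C D) \<longrightarrow> G \<in> Obj (Fun C D) \<longrightarrow> adjunction (Fun C D) F G \<sigma> \<rho> \<eta> \<epsilon> \<longrightarrow>
        (\<forall>x \<in> Obj C. adjunction D (fob F x) (fob G x) (tob \<sigma> x) (tob \<rho> x) (mob \<eta> x) (mob \<epsilon> x))) \<and>
     (\<forall>F G \<rho> (s :: 'o \<Rightarrow> 'b) (e :: 'o \<Rightarrow> 'u) (c :: 'o \<Rightarrow> 'u).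
        strict_functor C D F \<longrightarrow> strict_functor C D G \<longrightarrow> pseudo_natural C D G F \<rho> \<longrightarrow>
        (\<forall>x \<in> Obj C. adjunction D (fob F x) (fob G x) (s x) (tob \<rho> x) (e x) (c x)) \<longrightarrow>
        (\<exists>\<sigma> \<eta> \<epsilon>.
           oplax_natural C D F G \<sigma> \<and>
           is_modification C D F F (id_transformation C D F) (comp_transformation C D \<rho> \<sigma>) \<eta> \<and>
           is_modification C D G G (comp_transformation C D \<sigma> \<rho>) (id_transformation C D G) \<epsilon> \<and>
           (\<forall>x \<in> Obj C. tob \<sigma> x = s x \<and> mob \<eta> x = e x \<and> mob \<epsilon> x = c x) \<and>
           adjunction (Fun C D) F G \<sigma> \<rho> \<eta> \<epsilon>) \<and>
        (\<forall>\<sigma> \<eta> \<epsilon> \<sigma>' \<eta>' \<epsilon>'.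
           adjunction (Fun C D) F G \<sigma> \<rho> \<eta> \<epsilon> \<longrightarrow> adjunction (Fun C D) F G \<sigma>' \<rho> \<eta>' \<epsilon>' \<longrightarrow>
           left_adjoint_comparison (Fun C D) \<sigma> \<epsilon> \<sigma>' \<eta>' \<in> hom2 (Fun C D) \<sigma> \<sigma>' \<and>
           invertible2 (Fun C D) (left_adjoint_comparison (Fun C D) \<sigma> \<epsilon> \<sigma>' \<eta>')))"
proof -
  interpret two_categories C D
    using assms by (simp add: two_categories_def)
  interpret FunCD: two_category "Fun C D"
    by (rule two_category_Fun)
  show ?thesis
  proof (intro conjI allI impI ballI)
    fix F G \<rho> and s :: "'o \<Rightarrow> 'b" and e c :: "'o \<Rightarrow> 'u"
    assume "pseudo_natural C D G F \<rho>"
      and "\<forall>x \<in> Obj C. adjunction D (fob F x) (fob G x) (s x) (tob \<rho> x) (e x) (c x)"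
    then interpret pseudo_with_left_adjoints C D F G \<rho> s e c
      by unfold_locales auto
    show "\<exists>\<sigma> \<eta> \<epsilon>.
           oplax_natural C D F G \<sigma> \<and>
           is_modification C D F F (id_transformation C D F) (comp_transformation C D \<rho> \<sigma>) \<eta> \<and>
           is_modification C D G G (comp_transformation C D \<sigma> \<rho>) (id_transformation C D G) \<epsilon> \<and>
           (\<forall>x \<in> Obj C. tob \<sigma> x = s x \<and> mob \<eta> x = e x \<and> mob \<epsilon> x = c x) \<and>
           adjunction (Fun C D) F G \<sigma> \<rho> \<eta> \<epsilon>"
    proof (intro exI conjI ballI)
      \<comment> \<open>This instantiates the first existential; the two modification facts used
        below then instantiate the other two.\<close>
      show "oplax_natural C D F G sigma"
        by (rule oplax_natural_sigma)
    qed (rule is_modification_unit is_modification_counit adjunction_sigma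
        | simp add: unit_def counit_def)+
  \<comment> \<open>What is left is the componentwise direction and uniqueness, the latter being
    uniqueness of left adjoints in the 2-category \<open>Fun C D\<close>.\<close>
  qed (blast intro: adjunction_Fun_component FunCD.left_adjoint_comparison_cell
      FunCD.left_adjoint_comparison_invertible)+
qed

end
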